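(* Let $d$ be a positive integer, $\epsilon>0$, and let $p^0\in\mathbb{R}^d_{>0}$ be a probability vector. For each $n$ let $X_1,\dots,X_n$ be i.i.d. $\mathrm{Multinomial}(1,p)$, let $H=\sum_{i=1}^n X_i\sim \mathrm{Multinomial}(n,p)$, and let $\check H=\sum_{i=1}^n \mathcal{M}_{\mathtt{EXP}}(X_i,\epsilon)$, where the mechanism is applied with independent randomness to each entry. Set $\check p^0=\frac{1}{e^\epsilon+d-1}\left(e^\epsilon p^0+(\mathbf{1}-p^0)\right)$ and $$T^{(n)}_{\mathrm{Exp}}(\epsilon)=\sum_{j=1}^d\frac{(\check H_j-n\check p^0_j)^2}{n\check p^0_j}.$$ (i) Under the null hypothesis $p=p^0$, $T^{(n)}_{\mathrm{Exp}}(\epsilon)\xrightarrow{D}\chi^2_{d-1}$ as $n\to\infty$. (ii) Let $\Delta\in\mathbb{R}^d$ be fixed with $\mathbf{1}^\top\Delta=0$. Under the alternate hypothesis $p=p^1_n:=p^0+\frac{\Delta}{\sqrt n}$, $$T^{(n)}_{\mathrm{Exp}}(\epsilon)\xrightarrow{D}\chi^2_{d-1}\left(\left(\frac{e^\epsilon-1}{e^\epsilon+d-1}\right)^2\sum_{j=1}^d\frac{\Delta_j^2}{\check p^0_j}\right)\quad\text{as } n\to\infty.$$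
   Context: $e_1,\dots,e_d$ is the standard basis of $\mathbb{R}^d$ and $\mathbf{1}$ is the all-ones vector. A $\mathrm{Multinomial}(1,p)$ variable equals $e_j$ with probability $p_j$. The mechanism $\mathcal{M}_{\mathtt{EXP}}(x,\epsilon)$ takes $x\in\{e_1,\dots,e_d\}$ and outputs a random $\check x\in\{e_1,\dots,e_d\}$ with $\Pr[\check x=x]=\frac{e^\epsilon}{e^\epsilon-1+d}$ and $\Pr[\check x=z]=\frac{1}{e^\epsilon-1+d}$ for each $z\in\{e_1,\dots,e_d\}$, $z\ne x$. $\chi^2_\nu(\lambda)$ denotes the noncentral chi-square distribution with $\nu$ degrees of freedom and noncentrality parameter $\lambda$, i.e. the law of $\|N(\mu,I_\nu)\|^2$ with $\|\mu\|^2=\lambda$; $\chi^2_\nu=\chi^2_\nu(0)$. $\xrightarrow{D}$ is convergence in distribution. In (ii), the data for each $n$ (large enough that $p_n^1$ has positive entries) are drawn from $p^1_n$. *)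

theory Defs
  imports "HOL-Probability.Probability"
begin

section \<open>Noncentral chi-square distributions\<close>

text \<open>Coordinates are indexed by \<open>{..<\<nu>}\<close>, so that \<open>\<nu>\<close> is a number
  (possibly \<open>0\<close>) and not a type.\<close>

definition unit_gaussian :: "nat \<Rightarrow> (nat \<Rightarrow> real) \<Rightarrow> (nat \<Rightarrow> real) measure" where
  "unit_gaussian \<nu> \<mu> = (\<Pi>\<^sub>M i\<in>{..<\<nu>}. density lborel (\<lambda>x. ennreal (normal_density (\<mu> i) 1 x)))"

definition sq_norm_law :: "nat \<Rightarrow> (nat \<Rightarrow> real) \<Rightarrow> real measure" where
  "sq_norm_law \<nu> \<mu> = distr (unit_gaussian \<nu> \<mu>) borel (\<lambda>x. \<Sum>i<\<nu>. (x i)\<^sup>2)"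

text \<open>The mean is taken to be \<open>(sqrt l, 0, \<dots>, 0)\<close>; lemma \<open>sq_norm_law_eq\<close>
  below shows that every mean vector of squared length \<open>l\<close> gives the same law.\<close>

definition noncentral_chi_square :: "nat \<Rightarrow> real \<Rightarrow> real measure" where
  "noncentral_chi_square \<nu> l = sq_norm_law \<nu> (\<lambda>i. if i = 0 then sqrt l else 0)"

abbreviation chi_square :: "nat \<Rightarrow> real measure" where
  "chi_square \<nu> \<equiv> noncentral_chi_square \<nu> 0"

definition sq_normal :: "real \<Rightarrow> real measure" where
  "sq_normal a = distr (density lborel (\<lambda>x. ennreal (normal_density a 1 x))) borel (\<lambda>x. x\<^sup>2)"

lemma prob_space_sq_normal: "prob_space (sq_normal a)"
  unfolding sq_normal_def
  by (intro prob_space.prob_space_distr prob_space_normal_density) auto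

lemma finite_sq_normal [simp]: "finite_measure (sq_normal a)"
  using prob_space_sq_normal prob_space.finite_measure by blast

lemma sets_sq_normal [simp, measurable_cong]: "sets (sq_normal a) = sets borel"
  by (simp add: sq_normal_def)

lemma prob_space_unit_gaussian: "prob_space (unit_gaussian \<nu> \<mu>)"
  unfolding unit_gaussian_def by (intro prob_space_PiM prob_space_normal_density) auto

lemma sets_unit_gaussian [measurable_cong]:
  "sets (unit_gaussian \<nu> \<mu>) = sets (\<Pi>\<^sub>M i\<in>{..<\<nu>}. borel)"
  unfolding unit_gaussian_def by (intro sets_PiM_cong) auto

lemma prob_space_sq_norm_law: "prob_space (sq_norm_law \<nu> \<mu>)"
  unfolding sq_norm_law_def
  by (intro prob_space.prob_space_distr prob_space_unit_gaussian) measurable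

lemma finite_sq_norm_law [simp]: "finite_measure (sq_norm_law \<nu> \<mu>)"
  using prob_space_sq_norm_law prob_space.finite_measure by blast

lemma sets_sq_norm_law [simp, measurable_cong]: "sets (sq_norm_law \<nu> \<mu>) = sets borel"
  by (simp add: sq_norm_law_def)

lemma emeasure_distr_indicator:
  assumes [measurable]: "f \<in> M \<rightarrow>\<^sub>M borel" "A \<in> sets borel"
  shows "emeasure (distr M borel f) A = (\<integral>\<^sup>+x. indicator A (f x) \<partial>M)"
proof -
  have "emeasure (distr M borel f) A = (\<integral>\<^sup>+x. indicator A x \<partial>distr M borel f)" by simp
  also have "\<dots> = (\<integral>\<^sup>+x. indicator A (f x) \<partial>M)" by (rule nn_integral_distr) auto
  finally show ?thesis .
qed

lemma nn_integral_shear: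
  fixes F :: "real \<times> real \<Rightarrow> ennreal"
  assumes [measurable]: "F \<in> borel_measurable (borel \<Otimes>\<^sub>M borel)"
  shows "(\<integral>\<^sup>+y. \<integral>\<^sup>+x. F (x + t * y, y) \<partial>lborel \<partial>lborel) = (\<integral>\<^sup>+y. \<integral>\<^sup>+x. F (x, y) \<partial>lborel \<partial>lborel)"
proof (rule nn_integral_cong)
  fix y :: real
  show "(\<integral>\<^sup>+x. F (x + t * y, y) \<partial>lborel) = (\<integral>\<^sup>+x. F (x, y) \<partial>lborel)"
    by (subst (2) nn_integral_real_affine[where c=1 and t="t * y"]) (auto simp: add.commute)
qed

lemma nn_integral_swap:
  fixes F :: "real \<times> real \<Rightarrow> ennreal"
  assumes [measurable]: "F \<in> borel_measurable (borel \<Otimes>\<^sub>M borel)"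
  shows "(\<integral>\<^sup>+y. \<integral>\<^sup>+x. F (x, y) \<partial>lborel \<partial>lborel) = (\<integral>\<^sup>+x. \<integral>\<^sup>+y. F (x, y) \<partial>lborel \<partial>lborel)"
proof -
  have "F \<in> borel_measurable (lborel \<Otimes>\<^sub>M lborel)" by measurable
  then show ?thesis by (rule lborel_pair.Fubini)
qed

lemma nn_integral_rotate:
  fixes F :: "real \<times> real \<Rightarrow> ennreal"
  assumes [measurable]: "F \<in> borel_measurable (borel \<Otimes>\<^sub>M borel)"
    and cs: "c\<^sup>2 + s\<^sup>2 = 1" and s: "s \<noteq> 0"
  shows "(\<integral>\<^sup>+y. \<integral>\<^sup>+x. F (c * x - s * y, s * x + c * y) \<partial>lborel \<partial>lborel)
       = (\<integral>\<^sup>+y. \<integral>\<^sup>+x. F (x, y) \<partial>lborel \<partial>lborel)"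
proof -
  define t where "t = (c - 1) / s"
  have st: "s * t = c - 1" using s by (simp add: t_def)
  have "s * (t + c * t + s) = 0" using st cs by algebra
  hence t2: "t + c * t = - s" using s by simp
  define G where "G = (\<lambda>(x, y). F (x + t * y, y))"
  have [measurable]: "G \<in> borel_measurable (borel \<Otimes>\<^sub>M borel)"
    unfolding G_def by measurable
  define K where "K = (\<lambda>(x, y). G (x, y + s * x))"
  have [measurable]: "K \<in> borel_measurable (borel \<Otimes>\<^sub>M borel)"
    unfolding K_def by measurable
  have e: "K (x + t * y, y) = F (c * x - s * y, s * x + c * y)" for x y
  proof -
    have "x + t * y + t * (y + s * (x + t * y)) = x * (1 + s * t) + y * (t + t * (1 + s * t))"
      by (simp add: algebra_simps)
    also have "\<dots> = c * x - s * y" using st t2 by (simp add: algebra_simps)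
    finally have 1: "x + t * y + t * (y + s * (x + t * y)) = c * x - s * y" .
    have "y + s * (x + t * y) = s * x + (1 + s * t) * y" by (simp add: algebra_simps)
    also have "\<dots> = s * x + c * y" using st by simp
    finally have 2: "y + s * (x + t * y) = s * x + c * y" .
    show ?thesis using 1 unfolding K_def G_def by (simp add: 2)
  qed
  have "(\<integral>\<^sup>+y. \<integral>\<^sup>+x. F (c * x - s * y, s * x + c * y) \<partial>lborel \<partial>lborel)
      = (\<integral>\<^sup>+y. \<integral>\<^sup>+x. K (x, y) \<partial>lborel \<partial>lborel)"
    using nn_integral_shear[of K t] by (simp add: e)
  also have "\<dots> = (\<integral>\<^sup>+x. \<integral>\<^sup>+y. K (x, y) \<partial>lborel \<partial>lborel)"
    by (rule nn_integral_swap) measurable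
  also have "\<dots> = (\<integral>\<^sup>+x. \<integral>\<^sup>+y. G (x, y) \<partial>lborel \<partial>lborel)"
    using nn_integral_shear[of "\<lambda>(y, x). G (x, y)" s] by (simp add: K_def)
  also have "\<dots> = (\<integral>\<^sup>+y. \<integral>\<^sup>+x. G (x, y) \<partial>lborel \<partial>lborel)"
    by (rule nn_integral_swap[symmetric]) measurable
  also have "\<dots> = (\<integral>\<^sup>+y. \<integral>\<^sup>+x. F (x, y) \<partial>lborel \<partial>lborel)"
    using nn_integral_shear[of F t] by (simp add: G_def)
  finally show ?thesis .
qed

lemma sq_normal_minus: "sq_normal (- a) = sq_normal a"
proof (rule measure_eqI)
  fix A assume "A \<in> sets (sq_normal (- a))"
  hence [measurable]: "A \<in> sets borel" by simp
  have *: "emeasure (sq_normal b) A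
      = (\<integral>\<^sup>+x. ennreal (normal_density b 1 x) * indicator A (x\<^sup>2) \<partial>lborel)" for b
    unfolding sq_normal_def
    by (subst emeasure_distr_indicator) (auto simp: nn_integral_density)
  have "normal_density a 1 (- x) = normal_density (- a) 1 x" for x
    by (simp add: normal_density_def power2_eq_square algebra_simps)
  thus "emeasure (sq_normal (- a)) A = emeasure (sq_normal a) A"
    unfolding *
    by (subst (2) nn_integral_real_affine[where c="-1" and t=0]) auto
qed simp

lemma emeasure_sq_normal_conv:
  assumes [measurable]: "A \<in> sets borel"
  shows "emeasure (sq_normal a \<star> sq_normal b) A
    = (\<integral>\<^sup>+y. \<integral>\<^sup>+x. ennreal (exp (a * x + b * y - (x\<^sup>2 + y\<^sup>2 + (a\<^sup>2 + b\<^sup>2)) / 2) / (2 * pi))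
         * indicator A (x\<^sup>2 + y\<^sup>2) \<partial>lborel \<partial>lborel)"
proof -
  have *: "normal_density a 1 x * normal_density b 1 y
     = exp (a * x + b * y - (x\<^sup>2 + y\<^sup>2 + (a\<^sup>2 + b\<^sup>2)) / 2) / (2 * pi)" for x y
  proof -
    have "exp (- ((x - a)\<^sup>2 / 2)) * exp (- ((y - b)\<^sup>2 / 2))
        = exp (a * x + b * y - (x\<^sup>2 + y\<^sup>2 + (a\<^sup>2 + b\<^sup>2)) / 2)"
      unfolding exp_add[symmetric]
      by (rule arg_cong[of _ _ exp]) (simp add: power2_eq_square field_simps)
    moreover have "sqrt (2 * pi) * sqrt (2 * pi) = 2 * pi" by simp
    ultimately show ?thesis
      by (simp add: normal_density_def del: real_sqrt_mult)
  qed
  have "emeasure (sq_normal a \<star> sq_normal b) A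
     = (\<integral>\<^sup>+x. \<integral>\<^sup>+y. indicator A (x + y) \<partial>sq_normal b \<partial>sq_normal a)"
    by (rule convolution_emeasure') auto
  also have "\<dots> = (\<integral>\<^sup>+x. ennreal (normal_density a 1 x) *
       (\<integral>\<^sup>+y. ennreal (normal_density b 1 y) * indicator A (x\<^sup>2 + y\<^sup>2) \<partial>lborel) \<partial>lborel)"
    unfolding sq_normal_def by (simp add: nn_integral_distr nn_integral_density)
  also have "\<dots> = (\<integral>\<^sup>+x. \<integral>\<^sup>+y. ennreal (normal_density a 1 x * normal_density b 1 y) * indicator A (x\<^sup>2 + y\<^sup>2) \<partial>lborel \<partial>lborel)"
    by (simp add: nn_integral_cmult[symmetric] ennreal_mult' mult.assoc)
  also have "\<dots> = (\<integral>\<^sup>+y. \<integral>\<^sup>+x. ennreal (normal_density a 1 x * normal_density b 1 y) * indicator A (x\<^sup>2 + y\<^sup>2) \<partial>lborel \<partial>lborel)"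
    using nn_integral_swap[of "\<lambda>(x, y). ennreal (normal_density a 1 x * normal_density b 1 y) * indicator A (x\<^sup>2 + y\<^sup>2)"]
    by simp
  finally show ?thesis by (simp add: *)
qed

lemma sq_normal_conv:
  "(sq_normal a \<star> sq_normal b) = (sq_normal (sqrt (a\<^sup>2 + b\<^sup>2)) \<star> sq_normal 0)"
proof (cases "b = 0")
  case True
  have "sq_normal \<bar>a\<bar> = sq_normal a" using sq_normal_minus[of a] by (simp add: abs_if)
  with True show ?thesis by simp
next
  case False
  define r where "r = sqrt (a\<^sup>2 + b\<^sup>2)"
  have r: "r > 0" "r\<^sup>2 = a\<^sup>2 + b\<^sup>2"
    using False by (simp_all add: r_def sum_power2_gt_zero_iff)
  show ?thesis
  proof (rule measure_eqI)
    fix A assume "A \<in> sets (sq_normal a \<star> sq_normal b)"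
    hence A[measurable]: "A \<in> sets borel" by simp
    define F where "F = (\<lambda>(x, y). ennreal (exp (a * x + b * y - (x\<^sup>2 + y\<^sup>2 + (a\<^sup>2 + b\<^sup>2)) / 2) / (2 * pi))
         * indicator A (x\<^sup>2 + y\<^sup>2))"
    have [measurable]: "F \<in> borel_measurable (borel \<Otimes>\<^sub>M borel)"
      unfolding F_def by measurable
    have cs: "(a / r)\<^sup>2 + (b / r)\<^sup>2 = 1"
      unfolding power_divide add_divide_distrib[symmetric] r(2)[symmetric] using r(1) by simp
    have e: "F (a / r * x - b / r * y, b / r * x + a / r * y)
      = ennreal (exp (r * x + 0 * y - (x\<^sup>2 + y\<^sup>2 + (r\<^sup>2 + 0\<^sup>2)) / 2) / (2 * pi))
         * indicator A (x\<^sup>2 + y\<^sup>2)" for x y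
    proof -
      have "(a / r * x - b / r * y)\<^sup>2 + (b / r * x + a / r * y)\<^sup>2
          = ((a / r)\<^sup>2 + (b / r)\<^sup>2) * (x\<^sup>2 + y\<^sup>2)" by algebra
      hence 1: "(a / r * x - b / r * y)\<^sup>2 + (b / r * x + a / r * y)\<^sup>2 = x\<^sup>2 + y\<^sup>2"
        by (simp add: cs)
      have "a * (a / r * x - b / r * y) + b * (b / r * x + a / r * y) = (a\<^sup>2 + b\<^sup>2) / r * x"
        by (simp add: power2_eq_square add_divide_distrib algebra_simps)
      also have "\<dots> = r * x" using r(1) unfolding r(2)[symmetric] by (simp add: power2_eq_square)
      finally have 2: "a * (a / r * x - b / r * y) + b * (b / r * x + a / r * y) = r * x" .
      show ?thesis unfolding F_def prod.case 1 2 r(2) by simp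
    qed
    have "emeasure (sq_normal a \<star> sq_normal b) A = (\<integral>\<^sup>+y. \<integral>\<^sup>+x. F (x, y) \<partial>lborel \<partial>lborel)"
      by (simp add: emeasure_sq_normal_conv F_def)
    also have "\<dots> = (\<integral>\<^sup>+y. \<integral>\<^sup>+x. F (a / r * x - b / r * y, b / r * x + a / r * y) \<partial>lborel \<partial>lborel)"
      using False r(1) by (intro nn_integral_rotate[symmetric] cs) auto
    also have "\<dots> = emeasure (sq_normal r \<star> sq_normal 0) A"
      unfolding e emeasure_sq_normal_conv[OF A] ..
    finally show "emeasure (sq_normal a \<star> sq_normal b) A
        = emeasure (sq_normal (sqrt (a\<^sup>2 + b\<^sup>2)) \<star> sq_normal 0) A"
      by (simp add: r_def)
  qed simp
qed

lemma sq_norm_law_Suc: "sq_norm_law (Suc \<nu>) \<mu> = (sq_norm_law \<nu> \<mu> \<star> sq_normal (\<mu> \<nu>))"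
proof (rule measure_eqI)
  let ?N = "\<lambda>i. density lborel (\<lambda>x. ennreal (normal_density (\<mu> i) 1 x))"
  interpret product_sigma_finite ?N
    by (rule product_sigma_finite.intro)
       (simp add: prob_space_imp_sigma_finite prob_space_normal_density)
  fix A assume "A \<in> sets (sq_norm_law (Suc \<nu>) \<mu>)"
  hence [measurable]: "A \<in> sets borel" by simp
  have [measurable]: "(\<lambda>x. indicator A (\<Sum>i<Suc \<nu>. (x i)\<^sup>2) :: ennreal)
      \<in> borel_measurable (Pi\<^sub>M (insert \<nu> {..<\<nu>}) ?N)"
    by (auto simp: lessThan_Suc)
  have "emeasure (sq_norm_law (Suc \<nu>) \<mu>) A
     = (\<integral>\<^sup>+x. indicator A (\<Sum>i<Suc \<nu>. (x i)\<^sup>2) \<partial>unit_gaussian (Suc \<nu>) \<mu>)"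
    unfolding sq_norm_law_def by (rule emeasure_distr_indicator) measurable
  also have "\<dots> = (\<integral>\<^sup>+x. \<integral>\<^sup>+y. indicator A (\<Sum>i<Suc \<nu>. ((x(\<nu> := y)) i)\<^sup>2) \<partial>?N \<nu> \<partial>unit_gaussian \<nu> \<mu>)"
    unfolding unit_gaussian_def lessThan_Suc[of \<nu>]
    by (subst product_nn_integral_insert) (auto simp flip: lessThan_Suc)
  also have "\<dots> = (\<integral>\<^sup>+x. \<integral>\<^sup>+y. indicator A ((\<Sum>i<\<nu>. (x i)\<^sup>2) + y\<^sup>2) \<partial>?N \<nu> \<partial>unit_gaussian \<nu> \<mu>)"
    by simp
  also have "\<dots> = (\<integral>\<^sup>+x. \<integral>\<^sup>+y. indicator A (x + y) \<partial>sq_normal (\<mu> \<nu>) \<partial>sq_norm_law \<nu> \<mu>)"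
    unfolding sq_norm_law_def sq_normal_def
    by (subst (2) nn_integral_distr) (auto simp: nn_integral_distr nn_integral_density)
  also have "\<dots> = emeasure (sq_norm_law \<nu> \<mu> \<star> sq_normal (\<mu> \<nu>)) A"
    by (rule convolution_emeasure'[symmetric]) auto
  finally show "emeasure (sq_norm_law (Suc \<nu>) \<mu>) A = emeasure (sq_norm_law \<nu> \<mu> \<star> sq_normal (\<mu> \<nu>)) A" .
qed simp

lemma sq_norm_law_1: "sq_norm_law (Suc 0) \<mu> = sq_normal (\<mu> 0)"
proof (rule measure_eqI)
  fix A assume "A \<in> sets (sq_norm_law (Suc 0) \<mu>)"
  hence [measurable]: "A \<in> sets borel" by simp
  interpret sq: prob_space "sq_normal (\<mu> 0)" by (rule prob_space_sq_normal)
  have [measurable]: "(\<lambda>x. \<integral>\<^sup>+y. indicator A (x + y) \<partial>sq_normal (\<mu> 0)) \<in> borel_measurable borel"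
    by measurable
  have "emeasure (sq_norm_law (Suc 0) \<mu>) A = (\<integral>\<^sup>+x. \<integral>\<^sup>+y. indicator A (x + y) \<partial>sq_normal (\<mu> 0) \<partial>sq_norm_law 0 \<mu>)"
    unfolding sq_norm_law_Suc by (rule convolution_emeasure') auto
  also have "\<dots> = (\<integral>\<^sup>+y. indicator A y \<partial>sq_normal (\<mu> 0))"
    unfolding sq_norm_law_def[of 0]
    by (subst nn_integral_distr)
       (auto simp: prob_space.emeasure_space_1[OF prob_space_unit_gaussian])
  finally show "emeasure (sq_norm_law (Suc 0) \<mu>) A = emeasure (sq_normal (\<mu> 0)) A"
    by simp
qed simp

lemma noncentral_chi_square_conv:
  assumes "l \<ge> 0"
  shows "(noncentral_chi_square (Suc n) l \<star> sq_normal b)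
       = (noncentral_chi_square (Suc n) (l + b\<^sup>2) \<star> sq_normal 0)"
proof (induction n)
  case 0
  show ?case
    using assms sq_normal_conv[of "sqrt l" b] by (simp add: noncentral_chi_square_def sq_norm_law_1)
next
  case (Suc n)
  have S: "noncentral_chi_square (Suc (Suc n)) k = (noncentral_chi_square (Suc n) k \<star> sq_normal 0)" for k
    unfolding noncentral_chi_square_def by (subst sq_norm_law_Suc) simp
  have [simp]: "finite_measure (noncentral_chi_square k l)"
    "sets (noncentral_chi_square k l) = sets borel" for k l
    by (simp_all add: noncentral_chi_square_def)
  have "(noncentral_chi_square (Suc (Suc n)) l \<star> sq_normal b)
      = (noncentral_chi_square (Suc n) l \<star> (sq_normal 0 \<star> sq_normal b))"
    unfolding S by (rule convolution_associative[symmetric]) auto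
  also have "(sq_normal 0 \<star> sq_normal b) = (sq_normal b \<star> sq_normal 0)"
    by (rule convolution_commutative) auto
  also have "(noncentral_chi_square (Suc n) l \<star> (sq_normal b \<star> sq_normal 0))
      = ((noncentral_chi_square (Suc n) l \<star> sq_normal b) \<star> sq_normal 0)"
    by (rule convolution_associative) auto
  finally show ?case unfolding Suc.IH S .
qed

lemma sq_norm_law_eq:
  assumes "(\<Sum>i<\<nu>. (\<mu> i)\<^sup>2) = l"
  shows "sq_norm_law \<nu> \<mu> = noncentral_chi_square \<nu> l"
  using assms
proof (induction \<nu> arbitrary: l)
  case 0
  show ?case
    unfolding noncentral_chi_square_def sq_norm_law_def unit_gaussian_def
    by (rule arg_cong[where f = "\<lambda>M. distr M borel _"], rule PiM_cong) auto
next
  case (Suc n)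
  show ?case
  proof (cases n)
    case 0
    have "sq_normal \<bar>\<mu> 0\<bar> = sq_normal (\<mu> 0)"
      using sq_normal_minus[of "\<mu> 0"] by (simp add: abs_if)
    with 0 Suc.prems show ?thesis by (auto simp: noncentral_chi_square_def sq_norm_law_1)
  next
    case (Suc m)
    let ?l = "\<Sum>i<n. (\<mu> i)\<^sup>2"
    have "sq_norm_law (Suc n) \<mu> = (noncentral_chi_square n ?l \<star> sq_normal (\<mu> n))"
      by (simp add: sq_norm_law_Suc Suc.IH)
    also have "\<dots> = (noncentral_chi_square n (?l + (\<mu> n)\<^sup>2) \<star> sq_normal 0)"
      unfolding Suc by (intro noncentral_chi_square_conv sum_nonneg) auto
    also have "\<dots> = noncentral_chi_square (Suc n) l"
      using Suc.prems Suc by (simp add: noncentral_chi_square_def sq_norm_law_Suc[of "Suc m"])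
    finally show ?thesis .
  qed
qed


section \<open>The exponential mechanism and the test statistic\<close>

text \<open>The dimension is \<open>d = CARD('d)\<close>, the standard basis vectors are \<open>axis j 1\<close>, and
  \<open>1 :: real ^ 'd\<close> is the all-ones vector. As usual for \<open>embed_pmf\<close>, the law
  \<open>multinomial1 p\<close> is unspecified unless \<open>p\<close> is a probability vector.\<close>

definition prob_vector :: "real ^ 'd \<Rightarrow> bool" where
  "prob_vector p \<longleftrightarrow> (\<forall>j. p $ j \<ge> 0) \<and> (\<Sum>j\<in>UNIV. p $ j) = 1"

definition multinomial1 :: "real ^ 'd \<Rightarrow> (real ^ 'd) pmf" where
  "multinomial1 p = map_pmf (\<lambda>j. axis j 1) (embed_pmf (\<lambda>j. p $ j))"

definition exp_mech :: "real ^ 'd \<Rightarrow> real \<Rightarrow> (real ^ 'd) pmf" where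
  "exp_mech x \<epsilon> = map_pmf (\<lambda>j. axis j 1) (embed_pmf (\<lambda>j.
     (if axis j 1 = x then exp \<epsilon> else 1) / (exp \<epsilon> - 1 + real CARD('d))))"

lemma inj_axis_1: "inj (\<lambda>j. axis j (1::real) :: real ^ 'd)"
  by (auto simp: inj_on_def axis_eq_axis)

lemma pmf_multinomial1:
  assumes "prob_vector p"
  shows "pmf (multinomial1 p) (axis j 1) = p $ j"
proof -
  have "(\<integral>\<^sup>+ j. ennreal (p $ j) \<partial>count_space UNIV) = 1"
    using assms by (simp add: nn_integral_count_space_finite prob_vector_def sum_ennreal)
  thus ?thesis
    using assms unfolding multinomial1_def
    by (subst pmf_map_inj'[OF inj_axis_1]) (auto intro!: pmf_embed_pmf simp: prob_vector_def)
qed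

lemma pmf_exp_mech:
  assumes "\<epsilon> > 0"
  shows "pmf (exp_mech (axis k 1 :: real ^ 'd) \<epsilon>) (axis j 1)
    = (if j = k then exp \<epsilon> else 1) / (exp \<epsilon> - 1 + real CARD('d))"
proof -
  let ?D = "exp \<epsilon> - 1 + real CARD('d)"
  let ?f = "\<lambda>j. (if axis j (1::real) = (axis k 1 :: real ^ 'd) then exp \<epsilon> else 1) / ?D"
  have D: "?D > 0" using assms by (simp add: add_pos_pos)
  have "(\<Sum>j\<in>UNIV. ?f j) = (\<Sum>j\<in>UNIV. (if j = k then exp \<epsilon> - 1 else 0) + 1) / ?D"
    unfolding sum_divide_distrib by (intro sum.cong) (auto simp: axis_eq_axis)
  also have "\<dots> = 1" using D by (simp add: sum.distrib)
  finally have "(\<integral>\<^sup>+ j. ennreal (?f j) \<partial>count_space UNIV) = 1"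
    using D by (simp add: nn_integral_count_space_finite sum_ennreal)
  hence "pmf (embed_pmf ?f) j = ?f j"
    using D by (intro pmf_embed_pmf) auto
  thus ?thesis
    unfolding exp_mech_def by (subst pmf_map_inj'[OF inj_axis_1]) (simp add: axis_eq_axis)
qed

text \<open>The law of the privatized histogram: draw the data \<open>X\<^sub>1, \<dots>, X\<^sub>n\<close> independently,
  then apply the mechanism to each entry with fresh randomness, and sum.\<close>

definition private_hist :: "nat \<Rightarrow> real \<Rightarrow> real ^ 'd \<Rightarrow> (real ^ 'd) pmf" where
  "private_hist n \<epsilon> p = do {
     X \<leftarrow> Pi_pmf {1..n} 0 (\<lambda>_. multinomial1 p);
     Y \<leftarrow> Pi_pmf {1..n} 0 (\<lambda>i. exp_mech (X i) \<epsilon>);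
     return_pmf (\<Sum>i=1..n. Y i)
   }"

definition private_p :: "real \<Rightarrow> real ^ 'd \<Rightarrow> real ^ 'd" where
  "private_p \<epsilon> p\<^sub>0 = (1 / (exp \<epsilon> + real CARD('d) - 1)) *\<^sub>R (exp \<epsilon> *\<^sub>R p\<^sub>0 + (1 - p\<^sub>0))"

definition T_Exp :: "nat \<Rightarrow> real \<Rightarrow> real ^ 'd \<Rightarrow> real ^ 'd \<Rightarrow> real" where
  "T_Exp n \<epsilon> p\<^sub>0 h = (\<Sum>j\<in>UNIV. (h $ j - real n * private_p \<epsilon> p\<^sub>0 $ j)\<^sup>2 / (real n * private_p \<epsilon> p\<^sub>0 $ j))"

text \<open>The first vector is the null hypothesis \<open>p\<^sup>0\<close>, which enters the statistic; the second is
  the parameter \<open>p\<close> from which the data are drawn.\<close>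

definition T_Exp_law :: "nat \<Rightarrow> real \<Rightarrow> real ^ 'd \<Rightarrow> real ^ 'd \<Rightarrow> real measure" where
  "T_Exp_law n \<epsilon> p\<^sub>0 p = distr (measure_pmf (private_hist n \<epsilon> p)) borel (T_Exp n \<epsilon> p\<^sub>0)"

end

theory Submission
  imports Defs
begin

text \<open>
  The privatized histogram is a sum of \<open>n\<close> i.i.d. basis vectors with cell probabilities
  \<open>private_p \<epsilon> p\<close>, and \<open>T = |Z|\<^sup>2\<close> for \<open>Z\<^sub>j = (H\<^sub>j - n p\<^sub>j) / sqrt (n p\<^sub>j)\<close>, a vector orthogonal to the
  unit vector \<open>u = (sqrt p\<^sub>j)\<^sub>j\<close>. No multivariate central limit theorem is needed: for a standard
  Gaussian vector \<open>G\<close>, independent of \<open>Z\<close>, and \<open>s \<ge> 0\<close>,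
  \<open>E exp (- s T / 2) = sqrt (1 + s) E (exp (i sqrt s (G \<bullet> Z)) exp (- s (G \<bullet> u)\<^sup>2 / 2))\<close>,
  so that pointwise convergence of the characteristic function of \<open>Z\<close> (an explicit \<open>n\<close>-th power)
  and dominated convergence give the limit of the Laplace transform of \<open>T\<close>; the factor
  \<open>sqrt (1 + s)\<close> is what removes one degree of freedom. For laws on the half-line, convergence of
  \<open>E exp (- k T)\<close> for all natural \<open>k\<close> already implies weak convergence, by the Weierstrass theorem
  applied to functions of \<open>exp (- x)\<close>.
\<close>

section \<open>Weak convergence from Laplace transforms\<close>

text \<open>On the half-line \<open>exp (- x)\<close> is at most 1, so its powers are integrable.
  Polynomials in it are the test functions of the Weierstrass argument, and their integrals involve
  only Laplace transforms at natural numbers.\<close>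

lemma integral_sum_exp:
  fixes c :: "nat \<Rightarrow> real"
  assumes "prob_space M" "sets M = sets borel" "AE x in M. x \<ge> 0"
  shows "integrable M (\<lambda>x. \<Sum>i\<le>m. c i * exp (- x) ^ i)"
    and "(LINT x|M. (\<Sum>i\<le>m. c i * exp (- x) ^ i)) = (\<Sum>i\<le>m. c i * (LINT x|M. exp (- real i * x)))"
proof -
  interpret prob_space M by fact
  note [measurable_cong] = assms(2)
  have "AE x in M. norm (exp (- real i * x)) \<le> 1" for i
    using assms(3) by eventually_elim simp
  hence int: "integrable M (\<lambda>x. exp (- real i * x))" for i
    by (intro integrable_const_bound[where B = 1]) auto
  have eq: "exp (- x) ^ i = exp (- real i * x)" for i and x :: real
    by (simp add: exp_of_nat_mult[symmetric])
  show "integrable M (\<lambda>x. \<Sum>i\<le>m. c i * exp (- x) ^ i)"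
    unfolding eq using int by (intro Bochner_Integration.integrable_sum integrable_mult_right)
  show "(LINT x|M. (\<Sum>i\<le>m. c i * exp (- x) ^ i)) = (\<Sum>i\<le>m. c i * (LINT x|M. exp (- real i * x)))"
    unfolding eq using int by (subst Bochner_Integration.integral_sum) auto
qed

text \<open>The substitution \<open>u = - ln t\<close> compresses the half-line into the compact
  interval on which Weierstrass approximation applies; \<open>t = 0\<close> stands for
  \<open>u\<close> at infinity, where the step has already dropped to 0.\<close>

lemma continuous_on_cts_step_ln:
  assumes "x < y"
  shows "continuous_on {0..1} (\<lambda>t. if t \<le> 0 then 0 else cts_step x y (- ln t))"
proof -
  have cs: "continuous_on UNIV (cts_step x y)"
    using cts_step_uniformly_continuous[OF assms] by (rule uniformly_continuous_imp_continuous)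
  \<comment> \<open>Gluing at \<open>exp (- y)\<close> instead of 0 keeps \<open>ln\<close> away
    from its singularity; below that point \<open>- ln t\<close> is at least \<open>y\<close>, where
    the step vanishes.\<close>
  have "continuous_on ({0..exp (- y)} \<union> {exp (- y)..1}) (\<lambda>t. if t \<le> exp (- y) then 0 else cts_step x y (- ln t))"
  proof (rule continuous_on_If)
    show "continuous_on {exp (- y)..1} (\<lambda>t. cts_step x y (- ln t))"
      by (intro continuous_on_compose2[OF cs] continuous_intros) (auto simp: not_le intro: less_le_trans[OF exp_gt_zero])
  qed (use assms in \<open>auto simp: cts_step_def intro!: antisym\<close>)
  moreover have "(if t \<le> exp (- y) then 0 else cts_step x y (- ln t)) = (if t \<le> 0 then 0 else cts_step x y (- ln t))"
    for t
  proof (cases "0 < t \<and> t \<le> exp (- y)")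
    case True
    hence "ln t \<le> - y" by (metis ln_exp ln_le_cancel_iff exp_gt_zero)
    thus ?thesis using True assms by (simp add: cts_step_def)
  next
    case False
    thus ?thesis using exp_gt_zero[of "- y"] by (auto simp del: exp_gt_zero)
  qed
  ultimately show ?thesis by (auto elim: continuous_on_subset)
qed

lemma weak_conv_m_Laplace:
  fixes M :: "real measure"
  assumes "\<And>n. real_distribution (Mn n)" "\<And>n. AE x in Mn n. x \<ge> 0"
    and "real_distribution M" "AE x in M. x \<ge> 0"
    and lim: "\<And>k. (\<lambda>n. LINT x|Mn n. exp (- real k * x)) \<longlonglongrightarrow> (LINT x|M. exp (- real k * x))"
  shows "weak_conv_m Mn M"
proof (rule integral_cts_step_conv_imp_weak_conv)
  fix x y :: real assume xy: "x < y"
  define g where "g = (\<lambda>t. if t \<le> 0 then 0 else cts_step x y (- ln t))"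
  have step: "cts_step x y u = g (exp (- u))" for u
    by (simp add: g_def not_le)
  show "(\<lambda>n. integral\<^sup>L (Mn n) (cts_step x y)) \<longlonglongrightarrow> integral\<^sup>L M (cts_step x y)"
  proof (rule LIMSEQ_I)
    fix e :: real assume e: "0 < e"
    \<comment> \<open>Two approximation errors, one for \<open>Mn n\<close> and one for
      \<open>M\<close>, and the gap between the polynomial integrals cost at most
      \<open>e / 4\<close> each, so the total stays below \<open>e\<close>.\<close>
    obtain p where p: "real_polynomial_function p" "\<And>t. t \<in> {0..1} \<Longrightarrow> \<bar>g t - p t\<bar> < e / 4"
      using Stone_Weierstrass_real_polynomial_function[of "{0..1}" g "e / 4"]
        continuous_on_cts_step_ln[OF xy] e unfolding g_def by auto
    then obtain c m where pc: "p = (\<lambda>t. \<Sum>i\<le>m. c i * t ^ i)"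
      unfolding real_polynomial_function_iff_sum by blast
    have approx: "\<bar>integral\<^sup>L N (cts_step x y) - (\<Sum>i\<le>m. c i * (LINT x|N. exp (- real i * x)))\<bar> \<le> e / 4"
      if "real_distribution N" "AE x in N. x \<ge> 0" for N
    proof -
      interpret N: real_distribution N by fact
      note I = integral_sum_exp[OF N.prob_space_axioms _ that(2), of c m, simplified]
      have "\<bar>integral\<^sup>L N (cts_step x y) - (LINT x|N. p (exp (- x)))\<bar>
          = \<bar>LINT u|N. cts_step x y u - p (exp (- u))\<bar>"
        unfolding pc by (subst Bochner_Integration.integral_diff) (auto intro: N.integrable_cts_step xy I)
      also have "\<dots> \<le> (LINT u|N. \<bar>cts_step x y u - p (exp (- u))\<bar>)"
        by (rule integral_abs_bound)
      also have "\<dots> \<le> (LINT u|N. e / 4)"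
      proof (rule integral_mono_AE)
        show "integrable N (\<lambda>u. \<bar>cts_step x y u - p (exp (- u))\<bar>)"
          unfolding pc by (intro integrable_abs Bochner_Integration.integrable_diff N.integrable_cts_step xy I)
        show "AE u in N. \<bar>cts_step x y u - p (exp (- u))\<bar> \<le> e / 4"
          using that(2)
        proof eventually_elim
          case (elim u)
          with p(2)[of "exp (- u)"] show ?case by (simp add: step)
        qed
      qed simp
      also have "\<dots> = e / 4" by (simp add: N.prob_space[simplified])
      finally show ?thesis by (simp add: pc I)
    qed
    have "(\<lambda>n. \<Sum>i\<le>m. c i * (LINT x|Mn n. exp (- real i * x))) \<longlonglongrightarrow> (\<Sum>i\<le>m. c i * (LINT x|M. exp (- real i * x)))"
      by (intro tendsto_intros lim)
    from LIMSEQ_D[OF this, of "e / 4"] e obtain N where N: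
      "\<And>n. n \<ge> N \<Longrightarrow> \<bar>(\<Sum>i\<le>m. c i * (LINT x|Mn n. exp (- real i * x))) - (\<Sum>i\<le>m. c i * (LINT x|M. exp (- real i * x)))\<bar> < e / 4"
      by auto
    show "\<exists>no. \<forall>n\<ge>no. norm (integral\<^sup>L (Mn n) (cts_step x y) - integral\<^sup>L M (cts_step x y)) < e"
    proof (intro exI allI impI)
      fix n assume "n \<ge> N"
      from N[OF this] approx[OF assms(1,2), of n] approx[OF assms(3,4)] e
      show "norm (integral\<^sup>L (Mn n) (cts_step x y) - integral\<^sup>L M (cts_step x y)) < e"
        unfolding real_norm_def by linarith
    qed
  qed
qed (use assms in auto)

section \<open>Gaussian integrals\<close>

text \<open>Completing the square: the weight raises the precision from 1 to \<open>1 + s\<close>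
  and moves the mean to \<open>a / (1 + s)\<close>. Written as a multiple of a normal density, the
  product can be integrated through known facts about that density.\<close>

lemma normal_density_mult_exp_square:
  assumes "s \<ge> 0"
  shows "normal_density a 1 x * exp (- s / 2 * x\<^sup>2)
    = exp (- s * a\<^sup>2 / (2 * (1 + s))) / sqrt (1 + s) * normal_density (a / (1 + s)) (1 / sqrt (1 + s)) x"
proof -
  have s: "1 + s > 0" using assms by simp
  define m where "m = a / (1 + s)"
  have a: "a = (1 + s) * m" using s by (simp add: m_def)
  have e: "- (x - a)\<^sup>2 / 2 + - s / 2 * x\<^sup>2 = - s * a\<^sup>2 / (2 * (1 + s)) + - (x - m)\<^sup>2 * (1 + s) / 2"
    using s unfolding a by (simp add: divide_simps power_mult_distrib) algebra
  have "normal_density a 1 x * exp (- s / 2 * x\<^sup>2) = 1 / sqrt (2 * pi) * exp (- (x - a)\<^sup>2 / 2 + - s / 2 * x\<^sup>2)"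
    unfolding exp_add by (simp add: normal_density_def)
  also have "\<dots> = exp (- s * a\<^sup>2 / (2 * (1 + s))) / sqrt (1 + s) * normal_density m (1 / sqrt (1 + s)) x"
    unfolding e exp_add using s by (simp add: normal_density_def real_sqrt_divide power_divide)
  finally show ?thesis by (simp add: m_def)
qed

text \<open>The tilted density has mass 1, so only the constant from completing the square remains.
  This is the Laplace transform at \<open>s / 2\<close> of a noncentral chi-square variable with one
  degree of freedom.\<close>

lemma integral_normal_exp_square:
  assumes "s \<ge> 0"
  shows "(LINT x|density lborel (\<lambda>x. ennreal (normal_density a 1 x)). exp (- s / 2 * x\<^sup>2))
    = exp (- s * a\<^sup>2 / (2 * (1 + s))) / sqrt (1 + s)"
  using assms
  by (subst integral_density) (simp_all only: real_scaleR_def normal_density_mult_exp_square, auto simp: add_pos_nonneg)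

lemma integral_iexp_exp_square:
  assumes "s \<ge> 0"
  shows "(CLINT x|std_normal_distribution. iexp (t * x) * exp (- s / 2 * x\<^sup>2))
    = exp (- t\<^sup>2 / (2 * (1 + s))) / sqrt (1 + s)"
proof -
  define \<sigma> where "\<sigma> = 1 / sqrt (1 + s)"
  have \<sigma>: "\<sigma> > 0" "\<sigma>\<^sup>2 = 1 / (1 + s)" using assms by (simp_all add: \<sigma>_def power_divide)
  have scale: "\<sigma> * normal_density 0 \<sigma> (\<sigma> * x) = std_normal_density x" for x
    using \<sigma>(1) by (simp add: normal_density_def real_sqrt_mult power_mult_distrib)
  have "(CLINT x|std_normal_distribution. iexp (t * x) * exp (- s / 2 * x\<^sup>2))
      = (CLINT x|lborel. (std_normal_density x * exp (- s / 2 * x\<^sup>2)) *\<^sub>R iexp (t * x))"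
    by (subst integral_density) (auto simp: scaleR_conv_of_real mult_ac)
  also have "\<dots> = (CLINT x|lborel. \<sigma> *\<^sub>R (normal_density 0 \<sigma> x *\<^sub>R iexp (t * x)))"
    using assms by (simp only: normal_density_mult_exp_square) (simp add: \<sigma>_def)
  also have "\<dots> = \<sigma> *\<^sub>R (CLINT x|lborel. normal_density 0 \<sigma> x *\<^sub>R iexp (t * x))"
    by (rule integral_scaleR_right)
  \<comment> \<open>The outer \<open>\<sigma>\<close> is the normalization left by the weight; the
    inner one is the Jacobian of the rescaling to the standard normal density.\<close>
  also have "\<dots> = \<sigma> *\<^sub>R (CLINT x|lborel. (\<sigma> * normal_density 0 \<sigma> (\<sigma> * x)) *\<^sub>R iexp (t * \<sigma> * x))"
    using \<sigma>(1) by (subst lborel_integral_real_affine[where c = \<sigma> and t = 0])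
      (simp_all add: integral_scaleR_right[symmetric] mult_ac)
  also have "\<dots> = \<sigma> *\<^sub>R char std_normal_distribution (t * \<sigma>)"
    unfolding char_def scale by (subst integral_density) auto
  also have "\<dots> = exp (- t\<^sup>2 / (2 * (1 + s))) / sqrt (1 + s)"
    by (simp add: char_std_normal_distribution power_mult_distrib \<sigma>(2) scaleR_conv_of_real)
       (simp add: \<sigma>_def)
  finally show ?thesis .
qed

text \<open>Independence of the coordinates factors the transform, and the squared means add up to
  \<open>l\<close>. For \<open>\<nu> = 0\<close> there is no coordinate to carry a mean and the law
  is the point mass at 0, hence the last hypothesis.\<close>

lemma Laplace_noncentral_chi_square:
  assumes "s \<ge> 0" "l \<ge> 0" "\<nu> = 0 \<Longrightarrow> l = 0"
  shows "(LINT x|noncentral_chi_square \<nu> l. exp (- s / 2 * x)) = exp (- s * l / (2 * (1 + s))) / sqrt (1 + s) ^ \<nu>"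
proof -
  define a where "a = (\<lambda>i::nat. if i = 0 then sqrt l else 0)"
  have sum_a: "(\<Sum>i<\<nu>. (a i)\<^sup>2) = l"
  proof (cases \<nu>)
    case (Suc n)
    have "(\<Sum>i<Suc n. (a i)\<^sup>2) = (\<Sum>i<Suc n. if i = 0 then l else 0)"
      using assms(2) by (intro sum.cong) (auto simp: a_def)
    thus ?thesis unfolding Suc by simp
  qed (use assms in auto)
  let ?N = "\<lambda>i. density lborel (\<lambda>x. ennreal (normal_density (a i) 1 x))"
  interpret product_sigma_finite ?N
    by (rule product_sigma_finite.intro) (simp add: prob_space_imp_sigma_finite prob_space_normal_density)
  interpret N: prob_space "?N i" for i by (rule prob_space_normal_density) simp
  have "(LINT x|noncentral_chi_square \<nu> l. exp (- s / 2 * x)) = (LINT x|unit_gaussian \<nu> a. exp (- s / 2 * (\<Sum>i<\<nu>. (x i)\<^sup>2)))"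
    unfolding noncentral_chi_square_def sq_norm_law_def a_def[symmetric] by (subst integral_distr) measurable
  also have "\<dots> = (LINT x|unit_gaussian \<nu> a. (\<Prod>i<\<nu>. exp (- s / 2 * (x i)\<^sup>2)))"
    by (simp add: sum_distrib_left exp_sum)
  also have "\<dots> = (\<Prod>i<\<nu>. LINT x|?N i. exp (- s / 2 * x\<^sup>2))"
    unfolding unit_gaussian_def using assms(1)
    by (intro product_integral_prod) (auto intro!: N.integrable_const_bound[where B = 1])
  also have "\<dots> = (\<Prod>i<\<nu>. exp (- s * (a i)\<^sup>2 / (2 * (1 + s)))) / sqrt (1 + s) ^ \<nu>"
    using assms(1) by (simp only: integral_normal_exp_square prod_dividef) simp
  also have "(\<Prod>i<\<nu>. exp (- s * (a i)\<^sup>2 / (2 * (1 + s)))) = exp (- s * l / (2 * (1 + s)))"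
    unfolding exp_sum[OF finite_lessThan, symmetric] sum_a[symmetric]
    by (simp add: sum_distrib_left sum_divide_distrib sum_negf)
  finally show ?thesis .
qed

section \<open>Integrals over a standard Gaussian vector indexed by the cells\<close>

abbreviation std_gaussian :: "('i::finite \<Rightarrow> real) measure" where
  "std_gaussian \<equiv> (\<Pi>\<^sub>M i\<in>UNIV. std_normal_distribution)"

lemma prob_space_std_gaussian: "prob_space std_gaussian"
  by (intro prob_space_PiM prob_space_normal_density) simp

lemma integral_std_gaussian_prod:
  fixes f :: "'i::finite \<Rightarrow> real \<Rightarrow> complex"
  assumes "\<And>i. integrable std_normal_distribution (f i)"
  shows "(CLINT x|std_gaussian. (\<Prod>i\<in>UNIV. f i (x i))) = (\<Prod>i\<in>UNIV. integral\<^sup>L std_normal_distribution (f i))"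
proof -
  interpret product_sigma_finite "\<lambda>_::'i. std_normal_distribution"
    by (rule product_sigma_finite.intro) (simp add: prob_space_imp_sigma_finite prob_space_normal_density)
  show ?thesis using assms by (intro product_integral_prod) auto
qed

text \<open>Serves twice: at \<open>s = 0\<close> it is the characteristic function of the Gaussian
  vector, and for general \<open>s\<close> it evaluates the limiting integral for the
  statistic.\<close>

lemma integral_std_gaussian_iexp_exp_square:
  fixes b :: "'i::finite \<Rightarrow> real"
  assumes "s \<ge> 0"
  shows "(CLINT x|std_gaussian. iexp (\<Sum>i\<in>UNIV. b i * x i) * exp (- s / 2 * (\<Sum>i\<in>UNIV. (x i)\<^sup>2)))
    = exp (- (\<Sum>i\<in>UNIV. (b i)\<^sup>2) / (2 * (1 + s))) / sqrt (1 + s) ^ CARD('i)"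
proof -
  interpret N: prob_space std_normal_distribution by (rule prob_space_normal_density) simp
  have "(CLINT x|std_gaussian. iexp (\<Sum>i\<in>UNIV. b i * x i) * exp (- s / 2 * (\<Sum>i\<in>UNIV. (x i)\<^sup>2)))
    = (CLINT x|std_gaussian. (\<Prod>i\<in>UNIV. iexp (b i * x i) * exp (- s / 2 * (x i)\<^sup>2)))"
    by (simp add: sum_distrib_left exp_sum prod.distrib)
  also have "\<dots> = (\<Prod>i\<in>UNIV. CLINT x|std_normal_distribution. iexp (b i * x) * exp (- s / 2 * x\<^sup>2))"
    using assms
    by (intro integral_std_gaussian_prod) (auto intro!: N.integrable_const_bound[where B = 1] simp: norm_mult)
  also have "\<dots> = (\<Prod>i\<in>UNIV. complex_of_real (exp (- (b i)\<^sup>2 / (2 * (1 + s))) / sqrt (1 + s)))"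
    using assms by (simp only: integral_iexp_exp_square)
  also have "\<dots> = complex_of_real ((\<Prod>i\<in>UNIV. exp (- (b i)\<^sup>2 / (2 * (1 + s)))) / sqrt (1 + s) ^ CARD('i))"
    by (simp only: of_real_prod[symmetric] prod_dividef) simp
  also have "(\<Prod>i\<in>UNIV. exp (- (b i)\<^sup>2 / (2 * (1 + s)))) = exp (- (\<Sum>i\<in>UNIV. (b i)\<^sup>2) / (2 * (1 + s)))"
    by (simp add: exp_sum[symmetric] sum_divide_distrib sum_negf)
  finally show ?thesis .
qed

text \<open>The components of a Gaussian vector along the orthogonal directions \<open>z\<close> and
  \<open>u\<close> are independent, so the expectation splits into a characteristic function and the
  Laplace transform of a squared standard normal.\<close>

lemma gaussian_linearization:
  fixes z u :: "'i::finite \<Rightarrow> real"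
  assumes "s \<ge> 0" "(\<Sum>i\<in>UNIV. z i * u i) = 0" "(\<Sum>i\<in>UNIV. (u i)\<^sup>2) = 1"
  shows "(CLINT x|std_gaussian. iexp (sqrt s * (\<Sum>i\<in>UNIV. x i * z i)) * exp (- s / 2 * (\<Sum>i\<in>UNIV. x i * u i)\<^sup>2))
    = exp (- s / 2 * (\<Sum>i\<in>UNIV. (z i)\<^sup>2)) / sqrt (1 + s)"
proof -
  interpret N: prob_space std_normal_distribution by (rule prob_space_normal_density) simp
  interpret G: prob_space "std_gaussian :: ('i \<Rightarrow> real) measure" by (rule prob_space_std_gaussian)
  interpret NG: pair_prob_space std_normal_distribution "std_gaussian :: ('i \<Rightarrow> real) measure" ..
  \<comment> \<open>Integrate out an auxiliary standard normal \<open>h\<close> in the direction \<open>u\<close>, which turns the degenerate quadratic form into the full one.\<close>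
  have sq: "(\<Sum>i\<in>UNIV. (z i + h * u i)\<^sup>2) = (\<Sum>i\<in>UNIV. (z i)\<^sup>2) + h\<^sup>2" for h
  proof -
    have "(\<Sum>i\<in>UNIV. (z i + h * u i)\<^sup>2) = (\<Sum>i\<in>UNIV. (z i)\<^sup>2) + 2 * h * (\<Sum>i\<in>UNIV. z i * u i) + h\<^sup>2 * (\<Sum>i\<in>UNIV. (u i)\<^sup>2)"
      by (simp add: power2_eq_square algebra_simps sum.distrib sum_distrib_left)
    thus ?thesis using assms by simp
  qed
  \<comment> \<open>For fixed \<open>x\<close> the average over \<open>h\<close> is a normal
    characteristic function, and it reproduces the damping factor in the direction
    \<open>u\<close>.\<close>
  have 1: "(CLINT h|std_normal_distribution. iexp (sqrt s * (\<Sum>i\<in>UNIV. x i * (z i + h * u i))))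
      = iexp (sqrt s * (\<Sum>i\<in>UNIV. x i * z i)) * exp (- s / 2 * (\<Sum>i\<in>UNIV. x i * u i)\<^sup>2)" for x :: "'i \<Rightarrow> real"
  proof -
    let ?t = "sqrt s * (\<Sum>i\<in>UNIV. x i * u i)"
    have "(CLINT h|std_normal_distribution. iexp (sqrt s * (\<Sum>i\<in>UNIV. x i * (z i + h * u i))))
      = (CLINT h|std_normal_distribution. iexp (sqrt s * (\<Sum>i\<in>UNIV. x i * z i)) * iexp (?t * h))"
      by (simp add: exp_add[symmetric] algebra_simps sum.distrib sum_distrib_left)
    also have "\<dots> = iexp (sqrt s * (\<Sum>i\<in>UNIV. x i * z i)) * char std_normal_distribution ?t"
      unfolding char_def by (rule integral_mult_right_zero)
    finally show ?thesis using assms(1) by (simp add: char_std_normal_distribution power_mult_distrib)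
  qed
  have 2: "(CLINT x|std_gaussian. iexp (sqrt s * (\<Sum>i\<in>UNIV. x i * (z i + h * u i))))
      = exp (- s / 2 * (\<Sum>i\<in>UNIV. (z i)\<^sup>2)) * exp (- s / 2 * h\<^sup>2)" for h
  proof -
    \<comment> \<open>The trivial factor \<open>exp (- 0 / 2 * ...)\<close> brings the integrand
      into the form of the damped integral at damping 0; \<open>iexp (0 * h)\<close> plays the same
      part further below.\<close>
    have "(CLINT x|std_gaussian. iexp (sqrt s * (\<Sum>i\<in>UNIV. x i * (z i + h * u i))))
      = (CLINT x|std_gaussian. iexp (\<Sum>i\<in>UNIV. sqrt s * (z i + h * u i) * x i) * exp (- 0 / 2 * (\<Sum>i\<in>UNIV. (x i)\<^sup>2)))"
      by (simp add: sum_distrib_left mult_ac)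
    also have "\<dots> = exp (- (\<Sum>i\<in>UNIV. (sqrt s * (z i + h * u i))\<^sup>2) / 2)"
      by (subst integral_std_gaussian_iexp_exp_square) simp_all
    also have "(\<Sum>i\<in>UNIV. (sqrt s * (z i + h * u i))\<^sup>2) = s * ((\<Sum>i\<in>UNIV. (z i)\<^sup>2) + h\<^sup>2)"
      using assms(1) by (simp only: power_mult_distrib sum_distrib_left[symmetric] sq) simp
    also have "exp (- (s * ((\<Sum>i\<in>UNIV. (z i)\<^sup>2) + h\<^sup>2)) / 2) = exp (- s / 2 * (\<Sum>i\<in>UNIV. (z i)\<^sup>2)) * exp (- s / 2 * h\<^sup>2)"
      unfolding exp_add[symmetric] by (simp add: field_simps)
    finally show ?thesis by simp
  qed
  have "(CLINT x|std_gaussian. iexp (sqrt s * (\<Sum>i\<in>UNIV. x i * z i)) * exp (- s / 2 * (\<Sum>i\<in>UNIV. x i * u i)\<^sup>2))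
    = (CLINT x|std_gaussian. CLINT h|std_normal_distribution. iexp (sqrt s * (\<Sum>i\<in>UNIV. x i * (z i + h * u i))))"
    by (simp only: 1)
  also have "\<dots> = (CLINT h|std_normal_distribution. CLINT x|std_gaussian. iexp (sqrt s * (\<Sum>i\<in>UNIV. x i * (z i + h * u i))))"
    by (rule NG.Fubini_integral) (auto intro!: NG.integrable_const_bound[where B = 1])
  also have "\<dots> = (CLINT h|std_normal_distribution. exp (- s / 2 * (\<Sum>i\<in>UNIV. (z i)\<^sup>2)) * (iexp (0 * h) * exp (- s / 2 * h\<^sup>2)))"
    by (simp only: 2) simp
  also have "\<dots> = exp (- s / 2 * (\<Sum>i\<in>UNIV. (z i)\<^sup>2)) * (CLINT h|std_normal_distribution. iexp (0 * h) * exp (- s / 2 * h\<^sup>2))"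
    by (rule integral_mult_right_zero)
  also have "\<dots> = exp (- s / 2 * (\<Sum>i\<in>UNIV. (z i)\<^sup>2)) / sqrt (1 + s)"
    using assms(1) by (subst integral_iexp_exp_square) simp_all
  finally show ?thesis .
qed

section \<open>Limits of characteristic functions\<close>

lemma inverse_sqrt_tendsto_0: "(\<lambda>n. 1 / sqrt (real n)) \<longlonglongrightarrow> 0"
  by (intro tendsto_divide_0[OF tendsto_const] filterlim_at_top_imp_at_infinity
      filterlim_compose[OF sqrt_at_top filterlim_real_sequentially])

text \<open>The third-order Taylor remainder, multiplied by \<open>n\<close>, is at most
  \<open>\<bar>c\<bar> ^ 3 / (6 * sqrt n)\<close>.\<close>

lemma iexp_second_order_limit:
  "(\<lambda>n. of_nat n * (iexp (c / sqrt n) - 1 - \<i> * (c / sqrt n))) \<longlonglongrightarrow> complex_of_real (- c\<^sup>2 / 2)"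
proof (rule Lim_transform)
  show "(\<lambda>n. complex_of_real (- c\<^sup>2 / 2)) \<longlonglongrightarrow> complex_of_real (- c\<^sup>2 / 2)" by simp
  have "(\<lambda>n. \<bar>c\<bar> ^ 3 / 6 * (1 / sqrt (real n))) \<longlonglongrightarrow> 0"
    using tendsto_mult_right[OF inverse_sqrt_tendsto_0, of "\<bar>c\<bar> ^ 3 / 6"] by (simp add: mult.commute)
  moreover have "\<forall>\<^sub>F n in sequentially. norm (of_nat n * (iexp (c / sqrt n) - 1 - \<i> * (c / sqrt n)) - complex_of_real (- c\<^sup>2 / 2))
      \<le> \<bar>c\<bar> ^ 3 / 6 * (1 / sqrt (real n))"
    using eventually_gt_at_top[of 0]
  proof eventually_elim
    case (elim n)
    let ?x = "c / sqrt n"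
    have x2: "n * ?x\<^sup>2 = c\<^sup>2" using elim by (simp add: power_divide)
    have "of_nat n * (iexp ?x - 1 - \<i> * ?x) - complex_of_real (- c\<^sup>2 / 2)
        = of_nat n * (iexp ?x - 1 - \<i> * ?x) + complex_of_real (n * ?x\<^sup>2) / 2"
      unfolding x2 by simp
    also have "\<dots> = of_nat n * (iexp ?x - (\<Sum>k\<le>2. (\<i> * ?x)^k / fact k))"
    proof -
      have "(\<Sum>k\<le>2. (\<i> * ?x)^k / fact k) = 1 + \<i> * ?x + (\<i> * ?x)\<^sup>2 / 2"
        by (simp add: atMost_Suc numeral_2_eq_2)
      also have "(\<i> * ?x)\<^sup>2 = - (complex_of_real (?x\<^sup>2))"
        by (simp only: power_mult_distrib i_squared of_real_power) simp
      finally show ?thesis by (simp only: of_real_mult) (simp add: algebra_simps)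
    qed
    finally have "norm (of_nat n * (iexp ?x - 1 - \<i> * ?x) - complex_of_real (- c\<^sup>2 / 2))
        = n * norm (iexp ?x - (\<Sum>k\<le>2. (\<i> * ?x)^k / fact k))"
      by (simp only: norm_mult norm_of_nat)
    also have "\<dots> \<le> n * (\<bar>?x\<bar> ^ 3 / 6)"
      using iexp_approx1[of ?x 2] by (intro mult_left_mono) (auto simp: eval_nat_numeral)
    also have "\<dots> = (n * ?x\<^sup>2) * \<bar>?x\<bar> / 6"
      by (simp add: power3_eq_cube power2_eq_square abs_mult[symmetric])
    also have "\<dots> = \<bar>c\<bar> ^ 3 / 6 * (1 / sqrt (real n))"
      unfolding x2 by (simp add: power3_eq_cube power2_eq_square abs_mult[symmetric])
    finally show ?case .
  qed
  ultimately show "(\<lambda>n. of_nat n * (iexp (c / sqrt n) - 1 - \<i> * (c / sqrt n)) - complex_of_real (- c\<^sup>2 / 2)) \<longlonglongrightarrow> 0"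
    by (rule Lim_null_comparison[rotated])
qed

text \<open>The point \<open>w = exp (L / n)\<close> has \<open>w ^ n = exp L\<close> and lies in
  the unit disc because \<open>Re L \<le> 0\<close>. Within the disc \<open>n\<close>-th powers
  differ by at most \<open>n\<close> times the distance of the bases, and both
  \<open>n * (\<zeta> n - 1)\<close> and \<open>n * (w - 1)\<close> tend to \<open>L\<close>, the
  latter by differentiating \<open>exp (h * L)\<close> at \<open>h = 0\<close>.\<close>

lemma power_tendsto_exp:
  fixes \<zeta> :: "nat \<Rightarrow> complex"
  assumes "\<And>n. norm (\<zeta> n) \<le> 1" "Re L \<le> 0" "(\<lambda>n. of_nat n * (\<zeta> n - 1)) \<longlonglongrightarrow> L"
  shows "(\<lambda>n. \<zeta> n ^ n) \<longlonglongrightarrow> exp L"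
proof (rule Lim_transform)
  show "(\<lambda>n. exp L) \<longlonglongrightarrow> exp L" by simp
  have "((\<lambda>h. (exp (h * L) - 1) / h) \<longlongrightarrow> L) (at (0::complex))"
  proof -
    have "((\<lambda>h. exp (h * L)) has_field_derivative L) (at 0)"
      by (auto intro!: derivative_eq_intros)
    from DERIV_D[OF this] show ?thesis by simp
  qed
  moreover have "filterlim (\<lambda>n. 1 / of_nat n :: complex) (at 0) sequentially"
    unfolding filterlim_at by (auto intro!: lim_1_over_n eventually_sequentiallyI[of 1])
  ultimately have "(\<lambda>n. (exp (1 / of_nat n * L) - 1) / (1 / of_nat n)) \<longlonglongrightarrow> L"
    by (rule filterlim_compose)
  hence "(\<lambda>n. of_nat n * (\<zeta> n - 1) - (exp (1 / of_nat n * L) - 1) / (1 / of_nat n)) \<longlonglongrightarrow> L - L"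
    by (intro tendsto_diff assms)
  hence lim: "(\<lambda>n. norm (of_nat n * (\<zeta> n - 1) - (exp (1 / of_nat n * L) - 1) / (1 / of_nat n))) \<longlonglongrightarrow> 0"
    by (simp add: tendsto_norm_zero)
  have "\<forall>\<^sub>F n in sequentially. norm (\<zeta> n ^ n - exp L) \<le> norm (of_nat n * (\<zeta> n - 1) - (exp (1 / of_nat n * L) - 1) / (1 / of_nat n))"
    using eventually_gt_at_top[of 0]
  proof eventually_elim
    case (elim n)
    let ?w = "exp (1 / of_nat n * L)"
    have "?w ^ n = exp L" using elim by (simp add: exp_of_nat_mult[symmetric])
    moreover have "norm ?w \<le> 1" using assms(2) by (simp add: norm_exp_eq_Re divide_nonpos_nonneg Re_divide_of_nat)
    ultimately have "norm (\<zeta> n ^ n - exp L) \<le> n * norm (\<zeta> n - ?w)"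
      using norm_power_diff[of "\<zeta> n" ?w n] assms(1) by simp
    also have "\<dots> = norm (of_nat n * (\<zeta> n - ?w))" by (simp add: norm_mult)
    also have "of_nat n * (\<zeta> n - ?w) = of_nat n * (\<zeta> n - 1) - (?w - 1) / (1 / of_nat n)"
      by (simp add: algebra_simps)
    finally show ?case .
  qed
  thus "(\<lambda>n. \<zeta> n ^ n - exp L) \<longlonglongrightarrow> 0" by (rule Lim_null_comparison) (rule lim)
qed

text \<open>A central limit theorem for cell probabilities that drift at rate
  \<open>1 / sqrt n\<close>. The centering \<open>pc\<close> removes the first-order term that would
  grow like \<open>sqrt n\<close>; the drift \<open>\<delta>\<close> survives as a phase, and the
  second-order terms give the Gaussian factor.\<close>

lemma weighted_iexp_power_limit:
  fixes q :: "nat \<Rightarrow> 'i::finite \<Rightarrow> real" and c :: "'i \<Rightarrow> real"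
  assumes q: "\<And>n i. q n i \<ge> 0" "\<And>n. (\<Sum>i\<in>UNIV. q n i) = 1"
    and lim: "\<And>i. (\<lambda>n. sqrt n * (q n i - p i)) \<longlonglongrightarrow> \<delta> i"
    and pc: "(\<Sum>i\<in>UNIV. p i * c i) = 0" and p: "\<And>i. p i \<ge> 0"
  shows "(\<lambda>n. (\<Sum>i\<in>UNIV. q n i * iexp (c i / sqrt n)) ^ n)
    \<longlonglongrightarrow> iexp (\<Sum>i\<in>UNIV. \<delta> i * c i) * exp (- (\<Sum>i\<in>UNIV. p i * (c i)\<^sup>2) / 2)"
proof -
  let ?L = "\<i> * (\<Sum>i\<in>UNIV. \<delta> i * c i) + complex_of_real (\<Sum>i\<in>UNIV. p i * (- (c i)\<^sup>2 / 2))"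
  have qlim: "(\<lambda>n. q n i) \<longlonglongrightarrow> p i" for i
  proof -
    have "(\<lambda>n. p i + (1 / sqrt n) * (sqrt n * (q n i - p i))) \<longlonglongrightarrow> p i + 0 * \<delta> i"
      by (intro tendsto_intros lim inverse_sqrt_tendsto_0)
    moreover have "\<forall>\<^sub>F n in sequentially. p i + (1 / sqrt n) * (sqrt n * (q n i - p i)) = q n i"
      using eventually_gt_at_top[of 0] by eventually_elim simp
    ultimately show ?thesis by (auto dest: Lim_transform_eventually)
  qed
  have "(\<lambda>n. (\<Sum>i\<in>UNIV. q n i * iexp (c i / sqrt n)) ^ n) \<longlonglongrightarrow> exp ?L"
  proof (rule power_tendsto_exp)
    fix n
    have "norm (\<Sum>i\<in>UNIV. q n i * iexp (c i / sqrt n)) \<le> (\<Sum>i\<in>UNIV. norm (q n i * iexp (c i / sqrt n)))"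
      by (rule norm_sum)
    also have "\<dots> = 1" using q by (simp add: norm_mult)
    finally show "norm (\<Sum>i\<in>UNIV. q n i * iexp (c i / sqrt n)) \<le> 1" .
  next
    show "Re ?L \<le> 0" using p by (auto intro!: sum_nonpos mult_nonneg_nonpos)
  next
    have "(\<lambda>n. \<i> * (\<Sum>i\<in>UNIV. complex_of_real (sqrt n * (q n i - p i) * c i))
        + (\<Sum>i\<in>UNIV. complex_of_real (q n i) * (of_nat n * (iexp (c i / sqrt n) - 1 - \<i> * (c i / sqrt n))))) \<longlonglongrightarrow>
        \<i> * (\<Sum>i\<in>UNIV. complex_of_real (\<delta> i * c i)) + (\<Sum>i\<in>UNIV. complex_of_real (p i) * complex_of_real (- (c i)\<^sup>2 / 2))"
      by (intro tendsto_intros lim qlim iexp_second_order_limit)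
    moreover have "\<i> * (\<Sum>i\<in>UNIV. complex_of_real (sqrt n * (q n i - p i) * c i))
        + (\<Sum>i\<in>UNIV. complex_of_real (q n i) * (of_nat n * (iexp (c i / sqrt n) - 1 - \<i> * (c i / sqrt n))))
        = of_nat n * ((\<Sum>i\<in>UNIV. q n i * iexp (c i / sqrt n)) - 1)" for n :: nat
    proof -
      \<comment> \<open>At \<open>n = 0\<close> both sides are 0, since division by zero gives 0;
        the decomposition thus holds for every \<open>n\<close>.\<close>
      have n: "real n / sqrt n = sqrt n" by (simp add: real_div_sqrt)
      have "(\<Sum>i\<in>UNIV. complex_of_real (q n i) * (of_nat n * (iexp (c i / sqrt n) - 1 - \<i> * (c i / sqrt n))))
        = of_nat n * ((\<Sum>i\<in>UNIV. q n i * iexp (c i / sqrt n)) - of_real (\<Sum>i\<in>UNIV. q n i))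
          - \<i> * (\<Sum>i\<in>UNIV. complex_of_real ((real n / sqrt n) * q n i * c i))"
        by (simp add: algebra_simps sum_subtractf sum.distrib sum_distrib_left)
      also have "(\<Sum>i\<in>UNIV. complex_of_real ((real n / sqrt n) * q n i * c i))
        = of_real (\<Sum>i\<in>UNIV. sqrt n * q n i * c i)"
        unfolding n by (rule of_real_sum[symmetric])
      \<comment> \<open>Subtracting this zero leaves only the deviations \<open>q n i - p i\<close>,
        whose growth is controlled by \<open>lim\<close>.\<close>
      also have "(\<Sum>i\<in>UNIV. sqrt n * q n i * c i) = (\<Sum>i\<in>UNIV. sqrt n * q n i * c i) - sqrt n * (\<Sum>i\<in>UNIV. p i * c i)"
        by (simp add: pc)
      also have "\<dots> = (\<Sum>i\<in>UNIV. sqrt n * (q n i - p i) * c i)"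
        by (simp add: sum_distrib_left sum_subtractf[symmetric] algebra_simps)
      also have "of_real \<dots> = (\<Sum>i\<in>UNIV. complex_of_real (sqrt n * (q n i - p i) * c i))"
        by (rule of_real_sum)
      finally show ?thesis by (simp add: q)
    qed
    ultimately show "(\<lambda>n. of_nat n * ((\<Sum>i\<in>UNIV. q n i * iexp (c i / sqrt n)) - 1)) \<longlonglongrightarrow> ?L"
      by simp
  qed
  also have "exp ?L = iexp (\<Sum>i\<in>UNIV. \<delta> i * c i) * exp (- (\<Sum>i\<in>UNIV. p i * (c i)\<^sup>2) / 2)"
    unfolding exp_add exp_of_real by (simp add: sum_negf sum_divide_distrib)
  finally show ?thesis .
qed

section \<open>Sums of independent basis vectors\<close>

text \<open>Given the \<open>Pi_pmf\<close> form of \<open>private_hist\<close> so that the two can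
  be identified directly; inductions use the recursion below.\<close>

definition iid_sum_pmf :: "nat \<Rightarrow> (real ^ 'd) pmf \<Rightarrow> (real ^ 'd) pmf" where
  "iid_sum_pmf n W = map_pmf (\<lambda>Y. \<Sum>i=1..n. Y i) (Pi_pmf {1..n} 0 (\<lambda>_. W))"

lemma iid_sum_pmf_0: "iid_sum_pmf 0 W = return_pmf 0"
  by (simp add: iid_sum_pmf_def)

lemma iid_sum_pmf_Suc:
  "iid_sum_pmf (Suc n) W = do {y \<leftarrow> W; h \<leftarrow> iid_sum_pmf n W; return_pmf (h + y)}"
proof -
  have "{1..Suc n} = insert (Suc n) {1..n}" by auto
  moreover have "(\<Sum>i = 1..n. (f(Suc n := y)) i) = (\<Sum>i = 1..n. f i)" for f :: "nat \<Rightarrow> real ^ 'd" and y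
    by (intro sum.cong) auto
  ultimately show ?thesis
    by (simp add: iid_sum_pmf_def Pi_pmf_insert' map_bind_pmf bind_map_pmf add.commute)
qed

text \<open>Finite support turns expectations into finite sums, and the fixed total \<open>n\<close>
  is what makes the normalized counts orthogonal to the vector of square roots
  \<open>sqrt (p $ j)\<close>.\<close>

lemma set_iid_sum_pmf:
  fixes W :: "(real ^ 'd) pmf"
  assumes "set_pmf W \<subseteq> range (\<lambda>j. axis j 1)"
  shows "finite (set_pmf (iid_sum_pmf n W)) \<and> (\<forall>h\<in>set_pmf (iid_sum_pmf n W). (\<Sum>j\<in>UNIV. h $ j) = real n)"
proof (induction n)
  case (Suc n)
  have "finite (set_pmf W)" using assms by (rule finite_subset) simp
  moreover have "(\<Sum>j\<in>UNIV. y $ j) = 1" if y: "y \<in> set_pmf W" for y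
  proof -
    from y assms obtain k where "y = axis k 1" by auto
    thus ?thesis by (simp add: axis_def)
  qed
  ultimately show ?case using Suc by (auto simp: iid_sum_pmf_Suc sum.distrib)
qed (simp add: iid_sum_pmf_0)

text \<open>Characteristic functions multiply over independent summands, and a summand equal to the
  \<open>j\<close>-th basis vector contributes \<open>iexp (b j)\<close>.\<close>

lemma expectation_iid_sum_pmf_iexp:
  fixes W :: "(real ^ 'd) pmf" and b :: "'d \<Rightarrow> real"
  assumes W: "set_pmf W \<subseteq> range (\<lambda>j. axis j 1)"
  shows "measure_pmf.expectation (iid_sum_pmf n W) (\<lambda>h. iexp (\<Sum>j\<in>UNIV. b j * h $ j))
    = (\<Sum>j\<in>UNIV. pmf W (axis j 1) * iexp (b j)) ^ n"
proof (induction n)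
  case (Suc n)
  have fin: "finite (set_pmf W)" using W by (rule finite_subset) simp
  let ?e = "\<lambda>h::real ^ 'd. iexp (\<Sum>j\<in>UNIV. b j * h $ j)"
  have "measure_pmf.expectation W ?e = (\<Sum>x\<in>range (\<lambda>j. axis j 1). pmf W x *\<^sub>R ?e x)"
    using W by (intro integral_measure_pmf) auto
  also have "\<dots> = (\<Sum>j\<in>UNIV. pmf W (axis j 1) * iexp (b j))"
    by (subst sum.reindex[OF inj_axis_1]) (simp add: axis_def scaleR_conv_of_real if_distrib[of "\<lambda>x. _ * x"] del: of_real_mult of_real_sum cong: if_cong)
  finally have e: "measure_pmf.expectation W ?e = (\<Sum>j\<in>UNIV. pmf W (axis j 1) * iexp (b j))" .
  have "measure_pmf.expectation (iid_sum_pmf (Suc n) W) ?e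
      = (\<Sum>y\<in>set_pmf W. pmf W y *\<^sub>R measure_pmf.expectation (map_pmf (\<lambda>h. h + y) (iid_sum_pmf n W)) ?e)"
    unfolding iid_sum_pmf_Suc map_pmf_def[symmetric] using set_iid_sum_pmf[OF W, of n] fin
    by (intro pmf_expectation_bind) auto
  also have "\<dots> = (\<Sum>y\<in>set_pmf W. pmf W y *\<^sub>R (measure_pmf.expectation (iid_sum_pmf n W) (\<lambda>h. ?e h * ?e y)))"
    by (simp add: distrib_left sum.distrib exp_add)
  also have "\<dots> = (\<Sum>y\<in>set_pmf W. pmf W y *\<^sub>R ?e y) * measure_pmf.expectation (iid_sum_pmf n W) ?e"
    by (simp add: sum_distrib_left scaleR_conv_of_real mult_ac)
  also have "(\<Sum>y\<in>set_pmf W. pmf W y *\<^sub>R ?e y) = measure_pmf.expectation W ?e"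
    by (subst integral_measure_pmf[OF fin]) auto
  finally show ?case by (simp only: e Suc power_Suc)
qed (simp add: iid_sum_pmf_0)

section \<open>The Pearson statistic\<close>

definition pearson :: "nat \<Rightarrow> real ^ 'd \<Rightarrow> real ^ 'd \<Rightarrow> real" where
  "pearson n p h = (\<Sum>j\<in>UNIV. (h $ j - real n * p $ j)\<^sup>2 / (real n * p $ j))"

section \<open>Laplace transform of the Pearson statistic and its limit\<close>

lemma sum_pmf_axis:
  fixes W :: "(real ^ 'd) pmf"
  assumes "set_pmf W \<subseteq> range (\<lambda>j. axis j 1)"
  shows "(\<Sum>j\<in>UNIV. pmf W (axis j 1)) = 1"
  using sum_pmf_eq_1[OF _ assms] by (simp add: sum.reindex[OF inj_axis_1])

text \<open>Each histogram in the finite support is linearized with \<open>z\<close> its normalized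
  counts and \<open>u\<close> the square roots of \<open>p\<close>. Exchanging the finite sum with
  the Gaussian integral leaves, for each \<open>x\<close>, the characteristic function of the
  histogram, an \<open>n\<close>-th power.\<close>

lemma Laplace_pearson_eq:
  fixes W :: "(real ^ 'd) pmf" and p :: "real ^ 'd"
  assumes "n > 0" "s \<ge> 0" and p: "\<And>j. p $ j > 0" "(\<Sum>j\<in>UNIV. p $ j) = 1"
    and W: "set_pmf W \<subseteq> range (\<lambda>j. axis j 1)"
  defines "a \<equiv> (\<lambda>x :: 'd \<Rightarrow> real. \<Sum>j\<in>UNIV. x j * sqrt (p $ j))"
  shows "complex_of_real (measure_pmf.expectation (iid_sum_pmf n W) (\<lambda>h. exp (- s / 2 * pearson n p h)) / sqrt (1 + s))
    = (CLINT x|std_gaussian. (\<Sum>j\<in>UNIV. pmf W (axis j 1) * iexp (sqrt s * (x j / sqrt (p $ j) - a x) / sqrt n)) ^ n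
        * complex_of_real (exp (- s / 2 * (a x)\<^sup>2)))"
proof -
  interpret G: prob_space "std_gaussian :: ('d \<Rightarrow> real) measure" by (rule prob_space_std_gaussian)
  let ?S = "set_pmf (iid_sum_pmf n W)"
  let ?b = "\<lambda>x j. sqrt s * (x j / sqrt (p $ j) - a x) / sqrt n"
  let ?e = "\<lambda>h x. iexp (\<Sum>j\<in>UNIV. ?b x j * h $ j)"
  have fin: "finite ?S" and sum_h: "\<And>h. h \<in> ?S \<Longrightarrow> (\<Sum>j\<in>UNIV. h $ j) = real n"
    using set_iid_sum_pmf[OF W, of n] by auto
  have [measurable]: "a \<in> borel_measurable std_gaussian" unfolding a_def by measurable
  have lin: "complex_of_real (exp (- s / 2 * pearson n p h)) / sqrt (1 + s)
      = (CLINT x|std_gaussian. ?e h x * exp (- s / 2 * (a x)\<^sup>2))" if h: "h \<in> ?S" for h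
  proof -
    define z where "z = (\<lambda>j. (h $ j - real n * p $ j) / sqrt (real n * p $ j))"
    have sqn: "real n / sqrt n = sqrt n" by (simp add: real_div_sqrt)
    have sqp: "p $ j / sqrt (p $ j) = sqrt (p $ j)" for j using p(1)[of j] by (simp add: real_div_sqrt)
    have zj: "z j = h $ j / (sqrt n * sqrt (p $ j)) - sqrt n * sqrt (p $ j)" for j
    proof -
      have "z j = h $ j / (sqrt n * sqrt (p $ j)) - (real n / sqrt n) * (p $ j / sqrt (p $ j))"
        by (simp add: z_def real_sqrt_mult diff_divide_distrib)
      thus ?thesis by (simp only: sqn sqp)
    qed
    have "z j * sqrt (p $ j) = (h $ j - real n * p $ j) / sqrt n" for j
      using p(1)[of j] by (simp add: z_def real_sqrt_mult)
    hence "(\<Sum>j\<in>UNIV. z j * sqrt (p $ j)) = ((\<Sum>j\<in>UNIV. h $ j) - real n * (\<Sum>j\<in>UNIV. p $ j)) / sqrt n"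
      by (simp add: sum_divide_distrib[symmetric] sum_subtractf sum_distrib_left)
    hence orth: "(\<Sum>j\<in>UNIV. z j * sqrt (p $ j)) = 0" using sum_h[OF h] p(2) by simp
    have unit: "(\<Sum>j\<in>UNIV. (sqrt (p $ j))\<^sup>2) = 1" using p by (simp add: less_imp_le)
    have "(z j)\<^sup>2 = (h $ j - real n * p $ j)\<^sup>2 / (real n * p $ j)" for j
      using p(1)[of j] by (simp add: z_def power_divide)
    hence zz: "(\<Sum>j\<in>UNIV. (z j)\<^sup>2) = pearson n p h" by (simp add: pearson_def)
    \<comment> \<open>Since the counts total \<open>n\<close>, the constant from centering them can
      be absorbed as the shift \<open>- a x\<close> of the coefficients, which makes the exponent
      linear in \<open>h\<close>.\<close>
    have xz: "sqrt s * (\<Sum>j\<in>UNIV. x j * z j) = (\<Sum>j\<in>UNIV. ?b x j * h $ j)" for x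
    proof -
      have "(\<Sum>j\<in>UNIV. ?b x j * h $ j) = sqrt s * ((\<Sum>j\<in>UNIV. x j * (h $ j / (sqrt n * sqrt (p $ j)))) - a x * ((\<Sum>j\<in>UNIV. h $ j) / sqrt n))"
        by (simp add: sum_distrib_left sum_divide_distrib sum_subtractf algebra_simps diff_divide_distrib)
      also have "(\<Sum>j\<in>UNIV. h $ j) / sqrt n = sqrt n"
        unfolding sum_h[OF h] by (rule sqn)
      also have "a x * sqrt n = (\<Sum>j\<in>UNIV. x j * (sqrt n * sqrt (p $ j)))"
        by (simp add: a_def sum_distrib_left mult_ac)
      finally show ?thesis by (simp add: zj right_diff_distrib sum_subtractf)
    qed
    show ?thesis
      using gaussian_linearization[OF assms(2) orth unit] by (simp only: zz xz a_def of_real_divide)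
  qed
  have "complex_of_real (measure_pmf.expectation (iid_sum_pmf n W) (\<lambda>h. exp (- s / 2 * pearson n p h)) / sqrt (1 + s))
    = (\<Sum>h\<in>?S. pmf (iid_sum_pmf n W) h * (complex_of_real (exp (- s / 2 * pearson n p h)) / sqrt (1 + s)))"
    by (subst integral_measure_pmf[OF fin]) (auto simp: sum_divide_distrib)
  also have "\<dots> = (\<Sum>h\<in>?S. pmf (iid_sum_pmf n W) h * (CLINT x|std_gaussian. ?e h x * exp (- s / 2 * (a x)\<^sup>2)))"
    by (intro sum.cong refl) (simp only: lin)
  also have "\<dots> = (\<Sum>h\<in>?S. CLINT x|std_gaussian. pmf (iid_sum_pmf n W) h * (?e h x * exp (- s / 2 * (a x)\<^sup>2)))"
    by (simp only: integral_mult_right_zero)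
  also have "\<dots> = (CLINT x|std_gaussian. \<Sum>h\<in>?S. pmf (iid_sum_pmf n W) h * (?e h x * exp (- s / 2 * (a x)\<^sup>2)))"
    using assms(2)
    by (intro Bochner_Integration.integral_sum[symmetric] integrable_mult_right G.integrable_const_bound[where B = 1])
       (auto simp: norm_mult simp del: of_real_sum)
  also have "\<dots> = (CLINT x|std_gaussian. (\<Sum>h\<in>?S. pmf (iid_sum_pmf n W) h *\<^sub>R ?e h x) * exp (- s / 2 * (a x)\<^sup>2))"
    by (simp only: sum_distrib_right scaleR_conv_of_real mult.assoc)
  also have "\<dots> = (CLINT x|std_gaussian. measure_pmf.expectation (iid_sum_pmf n W) (\<lambda>h. ?e h x) * exp (- s / 2 * (a x)\<^sup>2))"
    by (subst integral_measure_pmf[OF fin]) auto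
  finally show ?thesis by (simp only: expectation_iid_sum_pmf_iexp[OF W])
qed

text \<open>Dominated convergence, with bound 1, in the exact Gaussian formula. The limiting
  integral contributes one factor \<open>1 / sqrt (1 + s)\<close> per cell, and multiplying back the
  \<open>sqrt (1 + s)\<close> of the linearization cancels one of them.\<close>

lemma Laplace_pearson_tendsto:
  fixes W :: "nat \<Rightarrow> (real ^ 'd) pmf" and p \<delta> :: "real ^ 'd"
  assumes "s \<ge> 0" and p: "\<And>j. p $ j > 0" "(\<Sum>j\<in>UNIV. p $ j) = 1"
    and W: "\<And>n. set_pmf (W n) \<subseteq> range (\<lambda>j. axis j 1)"
    and lim: "\<And>j. (\<lambda>n. sqrt n * (pmf (W n) (axis j 1) - p $ j)) \<longlonglongrightarrow> \<delta> $ j"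
    and \<delta>: "(\<Sum>j\<in>UNIV. \<delta> $ j) = 0"
  shows "(\<lambda>n. measure_pmf.expectation (iid_sum_pmf n (W n)) (\<lambda>h. exp (- s / 2 * pearson n p h)))
    \<longlonglongrightarrow> exp (- s * (\<Sum>j\<in>UNIV. (\<delta> $ j)\<^sup>2 / p $ j) / (2 * (1 + s))) / sqrt (1 + s) ^ (CARD('d) - 1)"
proof -
  interpret G: prob_space "std_gaussian :: ('d \<Rightarrow> real) measure" by (rule prob_space_std_gaussian)
  define a where "a = (\<lambda>x :: 'd \<Rightarrow> real. \<Sum>j\<in>UNIV. x j * sqrt (p $ j))"
  define c where "c = (\<lambda>x j. sqrt s * (x j / sqrt (p $ j) - a x))"
  let ?\<phi> = "\<lambda>n x. (\<Sum>j\<in>UNIV. pmf (W n) (axis j 1) * iexp (c x j / sqrt n)) ^ n"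
  let ?E = "\<lambda>n. measure_pmf.expectation (iid_sum_pmf n (W n)) (\<lambda>h. exp (- s / 2 * pearson n p h))"
  let ?l = "\<Sum>j\<in>UNIV. (\<delta> $ j)\<^sup>2 / p $ j"
  have [measurable]: "a \<in> borel_measurable std_gaussian" unfolding a_def by measurable
  have [measurable]: "(\<lambda>x. c x j) \<in> borel_measurable std_gaussian" for j unfolding c_def by measurable
  have sqp: "(sqrt (p $ j))\<^sup>2 = p $ j" "sqrt (p $ j) \<noteq> 0" for j
    using p(1)[of j] by simp_all
  have pxj: "p $ j * (x j / sqrt (p $ j)) = x j * sqrt (p $ j)" for x :: "'d \<Rightarrow> real" and j
    using sqp[of j] by (simp add: field_simps power2_eq_square)
  have pxj2: "p $ j * (x j / sqrt (p $ j))\<^sup>2 = (x j)\<^sup>2" for x :: "'d \<Rightarrow> real" and j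
    using sqp[of j] by (simp add: power_divide)
  have pc: "(\<Sum>j\<in>UNIV. p $ j * c x j) = 0" for x
  proof -
    have "(\<Sum>j\<in>UNIV. p $ j * c x j) = sqrt s * ((\<Sum>j\<in>UNIV. p $ j * (x j / sqrt (p $ j))) - a x * (\<Sum>j\<in>UNIV. p $ j))"
      by (simp add: c_def sum_distrib_left sum_subtractf algebra_simps)
    thus ?thesis by (simp only: pxj p(2)) (simp add: a_def)
  qed
  \<comment> \<open>The variance of \<open>c x\<close> under \<open>p\<close> is \<open>s\<close>
    times the squared length of the part of \<open>x\<close> orthogonal to the unit vector of the
    \<open>sqrt (p $ j)\<close>.\<close>
  have pc2: "(\<Sum>j\<in>UNIV. p $ j * (c x j)\<^sup>2) = s * ((\<Sum>j\<in>UNIV. (x j)\<^sup>2) - (a x)\<^sup>2)" for x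
  proof -
    have "(\<Sum>j\<in>UNIV. p $ j * (c x j)\<^sup>2) = (\<Sum>j\<in>UNIV. s * (p $ j * (x j / sqrt (p $ j))\<^sup>2)
        - s * (2 * a x * (p $ j * (x j / sqrt (p $ j)))) + s * ((a x)\<^sup>2 * p $ j))"
    proof (intro sum.cong refl)
      fix j
      have "w * (sqrt s * (y - a x))\<^sup>2 = s * (w * y\<^sup>2) - s * (2 * a x * (w * y)) + s * ((a x)\<^sup>2 * w)" for w y
        using assms(1) by (simp add: power_mult_distrib power2_diff algebra_simps)
      thus "p $ j * (c x j)\<^sup>2 = s * (p $ j * (x j / sqrt (p $ j))\<^sup>2)
        - s * (2 * a x * (p $ j * (x j / sqrt (p $ j)))) + s * ((a x)\<^sup>2 * p $ j)"
        by (simp only: c_def)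
    qed
    also have "\<dots> = s * (\<Sum>j\<in>UNIV. (x j)\<^sup>2) - s * (2 * a x * a x) + s * ((a x)\<^sup>2 * (\<Sum>j\<in>UNIV. p $ j))"
      by (simp only: pxj pxj2 sum.distrib sum_subtractf sum_distrib_left a_def)
    finally show ?thesis by (simp add: p(2) algebra_simps power2_eq_square)
  qed
  \<comment> \<open>The shift \<open>- a x\<close> is the same in all cells and drops out because
    \<open>\<delta>\<close> sums to 0.\<close>
  have dc: "(\<Sum>j\<in>UNIV. \<delta> $ j * c x j) = (\<Sum>j\<in>UNIV. sqrt s * \<delta> $ j / sqrt (p $ j) * x j)" for x
  proof -
    have "(\<Sum>j\<in>UNIV. \<delta> $ j * c x j) = (\<Sum>j\<in>UNIV. sqrt s * \<delta> $ j / sqrt (p $ j) * x j) - sqrt s * a x * (\<Sum>j\<in>UNIV. \<delta> $ j)"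
      by (simp add: c_def sum_distrib_left sum_subtractf algebra_simps)
    thus ?thesis by (simp add: \<delta>)
  qed
  have bound: "norm (\<Sum>j\<in>UNIV. pmf (W n) (axis j 1) * iexp (c x j / sqrt n)) \<le> 1" for n x
  proof -
    have "norm (\<Sum>j\<in>UNIV. pmf (W n) (axis j 1) * iexp (c x j / sqrt n)) \<le> (\<Sum>j\<in>UNIV. norm (pmf (W n) (axis j 1) * iexp (c x j / sqrt n)))"
      by (rule norm_sum)
    thus ?thesis by (simp add: norm_mult sum_pmf_axis[OF W])
  qed
  have "(\<lambda>n. CLINT x|std_gaussian. ?\<phi> n x * complex_of_real (exp (- s / 2 * (a x)\<^sup>2))) \<longlonglongrightarrow>
      (CLINT x|std_gaussian. iexp (\<Sum>j\<in>UNIV. sqrt s * \<delta> $ j / sqrt (p $ j) * x j) * complex_of_real (exp (- s / 2 * (\<Sum>j\<in>UNIV. (x j)\<^sup>2))))"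
  proof (rule integral_dominated_convergence[where w = "\<lambda>_. 1"])
    show "AE x in std_gaussian. (\<lambda>n. ?\<phi> n x * complex_of_real (exp (- s / 2 * (a x)\<^sup>2))) \<longlonglongrightarrow>
      iexp (\<Sum>j\<in>UNIV. sqrt s * \<delta> $ j / sqrt (p $ j) * x j) * complex_of_real (exp (- s / 2 * (\<Sum>j\<in>UNIV. (x j)\<^sup>2)))"
    proof (rule AE_I2)
      fix x :: "'d \<Rightarrow> real"
      have "(\<lambda>n. ?\<phi> n x) \<longlonglongrightarrow> iexp (\<Sum>j\<in>UNIV. \<delta> $ j * c x j) * complex_of_real (exp (- (\<Sum>j\<in>UNIV. p $ j * (c x j)\<^sup>2) / 2))"
        by (rule weighted_iexp_power_limit) (use lim pc p in \<open>auto simp: sum_pmf_axis[OF W] less_imp_le\<close>)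
      hence "(\<lambda>n. ?\<phi> n x * complex_of_real (exp (- s / 2 * (a x)\<^sup>2))) \<longlonglongrightarrow>
          iexp (\<Sum>j\<in>UNIV. \<delta> $ j * c x j) * complex_of_real (exp (- (\<Sum>j\<in>UNIV. p $ j * (c x j)\<^sup>2) / 2)) * complex_of_real (exp (- s / 2 * (a x)\<^sup>2))"
        by (intro tendsto_mult tendsto_const)
      also have "iexp (\<Sum>j\<in>UNIV. \<delta> $ j * c x j) * complex_of_real (exp (- (\<Sum>j\<in>UNIV. p $ j * (c x j)\<^sup>2) / 2)) * complex_of_real (exp (- s / 2 * (a x)\<^sup>2))
          = iexp (\<Sum>j\<in>UNIV. \<delta> $ j * c x j) * complex_of_real (exp (- (\<Sum>j\<in>UNIV. p $ j * (c x j)\<^sup>2) / 2 + - s / 2 * (a x)\<^sup>2))"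
        by (simp only: exp_add of_real_mult mult.assoc)
      \<comment> \<open>The damping factor restores exactly the \<open>(a x)\<^sup>2\<close> missing
        from the variance, so the limit is a product over all coordinates.\<close>
      also have "- (\<Sum>j\<in>UNIV. p $ j * (c x j)\<^sup>2) / 2 + - s / 2 * (a x)\<^sup>2 = - s / 2 * (\<Sum>j\<in>UNIV. (x j)\<^sup>2)"
        unfolding pc2 by (simp add: field_simps)
      finally show "(\<lambda>n. ?\<phi> n x * complex_of_real (exp (- s / 2 * (a x)\<^sup>2))) \<longlonglongrightarrow>
          iexp (\<Sum>j\<in>UNIV. sqrt s * \<delta> $ j / sqrt (p $ j) * x j) * complex_of_real (exp (- s / 2 * (\<Sum>j\<in>UNIV. (x j)\<^sup>2)))"
        unfolding dc .
    qed
    show "AE x in std_gaussian. norm (?\<phi> n x * complex_of_real (exp (- s / 2 * (a x)\<^sup>2))) \<le> 1" for n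
      using assms(1) bound[of n]
      by (intro AE_I2) (simp only: norm_mult norm_power norm_of_real, intro mult_le_one power_le_one, auto)
  qed auto
  also have "(CLINT x|std_gaussian. iexp (\<Sum>j\<in>UNIV. sqrt s * \<delta> $ j / sqrt (p $ j) * x j) * complex_of_real (exp (- s / 2 * (\<Sum>j\<in>UNIV. (x j)\<^sup>2))))
      = exp (- (\<Sum>j\<in>UNIV. (sqrt s * \<delta> $ j / sqrt (p $ j))\<^sup>2) / (2 * (1 + s))) / sqrt (1 + s) ^ CARD('d)"
    using assms(1) by (rule integral_std_gaussian_iexp_exp_square)
  also have "(\<Sum>j\<in>UNIV. (sqrt s * \<delta> $ j / sqrt (p $ j))\<^sup>2) = s * ?l"
    using assms(1) p(1) by (simp add: power_mult_distrib power_divide less_imp_le sum_distrib_left)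
  finally have "(\<lambda>n. CLINT x|std_gaussian. ?\<phi> n x * complex_of_real (exp (- s / 2 * (a x)\<^sup>2)))
      \<longlonglongrightarrow> complex_of_real (exp (- (s * ?l) / (2 * (1 + s))) / sqrt (1 + s) ^ CARD('d))" .
  moreover have "\<forall>\<^sub>F n in sequentially. (CLINT x|std_gaussian. ?\<phi> n x * complex_of_real (exp (- s / 2 * (a x)\<^sup>2))) = complex_of_real (?E n / sqrt (1 + s))"
    using eventually_gt_at_top[of 0]
  proof eventually_elim
    case (elim n)
    show ?case
      unfolding c_def a_def by (rule Laplace_pearson_eq[OF elim assms(1) p W, symmetric])
  qed
  ultimately have "(\<lambda>n. complex_of_real (?E n / sqrt (1 + s)))
      \<longlonglongrightarrow> complex_of_real (exp (- (s * ?l) / (2 * (1 + s))) / sqrt (1 + s) ^ CARD('d))"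
    by (rule Lim_transform_eventually)
  hence "(\<lambda>n. ?E n / sqrt (1 + s)) \<longlonglongrightarrow> exp (- (s * ?l) / (2 * (1 + s))) / sqrt (1 + s) ^ CARD('d)"
    by (simp only: tendsto_of_real_iff)
  hence "(\<lambda>n. ?E n / sqrt (1 + s) * sqrt (1 + s)) \<longlonglongrightarrow> exp (- (s * ?l) / (2 * (1 + s))) / sqrt (1 + s) ^ CARD('d) * sqrt (1 + s)"
    by (intro tendsto_mult tendsto_const)
  moreover have "sqrt (1 + s) ^ CARD('d) = sqrt (1 + s) ^ (CARD('d) - 1) * sqrt (1 + s)"
    by (metis Suc_diff_1 power_Suc2 zero_less_card_finite)
  ultimately show ?thesis using assms(1) by simp
qed

theorem weak_conv_pearson:
  fixes W :: "nat \<Rightarrow> (real ^ 'd) pmf" and p \<delta> :: "real ^ 'd"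
  assumes p: "\<And>j. p $ j > 0" "(\<Sum>j\<in>UNIV. p $ j) = 1"
    and W: "\<And>n. set_pmf (W n) \<subseteq> range (\<lambda>j. axis j 1)"
    and lim: "\<And>j. (\<lambda>n. sqrt n * (pmf (W n) (axis j 1) - p $ j)) \<longlonglongrightarrow> \<delta> $ j"
    and \<delta>: "(\<Sum>j\<in>UNIV. \<delta> $ j) = 0"
  shows "weak_conv_m (\<lambda>n. distr (measure_pmf (iid_sum_pmf n (W n))) borel (pearson n p))
    (noncentral_chi_square (CARD('d) - 1) (\<Sum>j\<in>UNIV. (\<delta> $ j)\<^sup>2 / p $ j))"
proof (rule weak_conv_m_Laplace)
  let ?l = "\<Sum>j\<in>UNIV. (\<delta> $ j)\<^sup>2 / p $ j"
  let ?\<chi> = "noncentral_chi_square (CARD('d) - 1) ?l"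
  have rd: "real_distribution M" if "prob_space M" "sets M = sets borel" for M :: "real measure"
    using that by (simp add: real_distribution_def real_distribution_axioms_def)
  show "real_distribution (distr (measure_pmf (iid_sum_pmf n (W n))) borel (pearson n p))" for n
    by (intro rd prob_space.prob_space_distr measure_pmf.prob_space_axioms) auto
  show "AE x in distr (measure_pmf (iid_sum_pmf n (W n))) borel (pearson n p). 0 \<le> x" for n
    using p(1) by (subst AE_distr_iff) (auto simp: pearson_def less_imp_le intro!: AE_I2 sum_nonneg divide_nonneg_nonneg)
  show "real_distribution ?\<chi>"
    unfolding noncentral_chi_square_def by (intro rd prob_space_sq_norm_law) simp
  show "AE x in ?\<chi>. 0 \<le> x"
    unfolding noncentral_chi_square_def sq_norm_law_def
    by (subst AE_distr_iff) (auto intro!: sum_nonneg AE_I2)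
  fix k
  have l: "?l \<ge> 0" using p(1) by (intro sum_nonneg divide_nonneg_nonneg) (auto intro: less_imp_le)
  \<comment> \<open>With a single cell the constraint on \<open>\<delta>\<close> forces it to
    vanish, which matches the degenerate law with zero degrees of freedom.\<close>
  have l0: "?l = 0" if "CARD('d) - 1 = 0"
  proof -
    have "CARD('d) = 1" using that zero_less_card_finite[where 'a='d] by linarith
    then obtain i :: 'd where i: "UNIV = {i}" by (rule card_1_singletonE)
    have "\<delta> $ i = 0" using \<delta> unfolding i by simp
    thus ?thesis unfolding i by simp
  qed
  \<comment> \<open>The choice \<open>s = 2 * k\<close> turns the Gaussian normalization
    \<open>- s / 2\<close> into the integer exponent \<open>- k\<close>.\<close>
  have "(LINT x|?\<chi>. exp (- (2 * real k) / 2 * x)) = exp (- (2 * real k) * ?l / (2 * (1 + 2 * real k))) / sqrt (1 + 2 * real k) ^ (CARD('d) - 1)"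
    by (rule Laplace_noncentral_chi_square) (use l l0 in auto)
  with Laplace_pearson_tendsto[OF _ p W lim \<delta>, of "2 * real k"]
  show "(\<lambda>n. LINT x|distr (measure_pmf (iid_sum_pmf n (W n))) borel (pearson n p). exp (- real k * x))
      \<longlonglongrightarrow> (LINT x|?\<chi>. exp (- real k * x))"
    by (simp add: integral_distr)
qed

section \<open>The exponential mechanism\<close>

text \<open>Independent draws followed by independent coordinatewise randomization form a product of
  binds, so each entry can be privatized as soon as it is drawn.\<close>

lemma private_hist_eq_iid_sum_pmf:
  "private_hist n \<epsilon> p = iid_sum_pmf n (bind_pmf (multinomial1 p) (\<lambda>x. exp_mech x \<epsilon>))"
  unfolding private_hist_def iid_sum_pmf_def
  by (subst Pi_pmf_bind[where d' = 0]) (simp_all add: map_bind_pmf map_pmf_def bind_assoc_pmf bind_return_pmf)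

lemma T_Exp_eq_pearson: "T_Exp n \<epsilon> p\<^sub>0 = pearson n (private_p \<epsilon> p\<^sub>0)"
  by (simp add: fun_eq_iff T_Exp_def pearson_def)

text \<open>Shows that privatization is affine in each cell, with slope
  \<open>(exp \<epsilon> - 1) / (exp \<epsilon> + real CARD('d) - 1)\<close>; the square of this
  slope scales the noncentrality.\<close>

lemma private_p_nth:
  fixes p :: "real ^ 'd"
  shows "private_p \<epsilon> p $ j = (1 + (exp \<epsilon> - 1) * p $ j) / (exp \<epsilon> + real CARD('d) - 1)"
  by (simp add: private_p_def add_divide_distrib diff_divide_distrib algebra_simps)

text \<open>Total probability over the true cell: every output receives the common weight 1, and the
  true cell the surplus \<open>exp \<epsilon> - 1\<close>, before normalization.\<close>

lemma pmf_private_entry: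
  fixes p :: "real ^ 'd"
  assumes "\<epsilon> > 0" "prob_vector p"
  shows "pmf (bind_pmf (multinomial1 p) (\<lambda>x. exp_mech x \<epsilon>)) (axis j 1) = private_p \<epsilon> p $ j"
proof -
  let ?D = "exp \<epsilon> + real CARD('d) - 1"
  have S: "set_pmf (multinomial1 p) \<subseteq> range (\<lambda>k. axis k 1)"
    by (auto simp: multinomial1_def)
  have "pmf (bind_pmf (multinomial1 p) (\<lambda>x. exp_mech x \<epsilon>)) (axis j 1)
      = (\<Sum>x\<in>range (\<lambda>k. axis k 1). pmf (multinomial1 p) x * pmf (exp_mech x \<epsilon>) (axis j 1))"
    unfolding pmf_bind using S by (subst integral_measure_pmf[of "range (\<lambda>k. axis k 1)"]) auto
  also have "\<dots> = (\<Sum>k\<in>UNIV. p $ k * ((if j = k then exp \<epsilon> else 1) / (exp \<epsilon> - 1 + real CARD('d))))"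
    by (subst sum.reindex[OF inj_axis_1]) (simp add: pmf_multinomial1[OF assms(2)] pmf_exp_mech[OF assms(1)])
  also have "\<dots> = (\<Sum>k\<in>UNIV. p $ k + (if j = k then (exp \<epsilon> - 1) * p $ k else 0)) / ?D"
    unfolding sum_divide_distrib by (intro sum.cong) (auto simp: algebra_simps)
  also have "\<dots> = private_p \<epsilon> p $ j"
    using assms(2) by (simp add: sum.distrib private_p_nth prob_vector_def)
  finally show ?thesis .
qed

lemma weak_conv_T_Exp_law:
  fixes \<epsilon> :: real and p\<^sub>0 \<Delta> :: "real ^ 'd"
  assumes "\<epsilon> > 0" "prob_vector p\<^sub>0" "\<And>j. p\<^sub>0 $ j > 0" "(\<Sum>j\<in>UNIV. \<Delta> $ j) = 0"
  shows "weak_conv_m (\<lambda>n. T_Exp_law n \<epsilon> p\<^sub>0 (p\<^sub>0 + (1 / sqrt (real n)) *\<^sub>R \<Delta>))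
        (noncentral_chi_square (CARD('d) - 1)
          (((exp \<epsilon> - 1) / (exp \<epsilon> + real CARD('d) - 1))\<^sup>2
            * (\<Sum>j\<in>UNIV. (\<Delta> $ j)\<^sup>2 / private_p \<epsilon> p\<^sub>0 $ j)))"
proof -
  let ?\<kappa> = "(exp \<epsilon> - 1) / (exp \<epsilon> + real CARD('d) - 1)"
  let ?p = "\<lambda>n. p\<^sub>0 + (1 / sqrt (real n)) *\<^sub>R \<Delta>"
  let ?W = "\<lambda>n. bind_pmf (multinomial1 (?p n)) (\<lambda>x. exp_mech x \<epsilon>)"
  have D: "exp \<epsilon> + real CARD('d) - 1 > 0"
    using assms(1) one_less_exp_iff[of \<epsilon>] by linarith
  have sum_p0: "(\<Sum>j\<in>UNIV. p\<^sub>0 $ j) = 1" using assms(2) by (simp add: prob_vector_def)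
  have "weak_conv_m (\<lambda>n. distr (measure_pmf (iid_sum_pmf n (?W n))) borel (pearson n (private_p \<epsilon> p\<^sub>0)))
    (noncentral_chi_square (CARD('d) - 1) (\<Sum>j\<in>UNIV. ((?\<kappa> *\<^sub>R \<Delta>) $ j)\<^sup>2 / private_p \<epsilon> p\<^sub>0 $ j))"
  proof (rule weak_conv_pearson)
    show "private_p \<epsilon> p\<^sub>0 $ j > 0" for j
      using assms(1) assms(3)[of j] D by (auto simp: private_p_nth intro!: divide_pos_pos add_pos_pos)
    have "(\<Sum>j\<in>UNIV. private_p \<epsilon> p\<^sub>0 $ j) = (real CARD('d) + (exp \<epsilon> - 1) * (\<Sum>j\<in>UNIV. p\<^sub>0 $ j)) / (exp \<epsilon> + real CARD('d) - 1)"
      by (simp add: private_p_nth sum_divide_distrib[symmetric] sum.distrib sum_distrib_left)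
    thus "(\<Sum>j\<in>UNIV. private_p \<epsilon> p\<^sub>0 $ j) = 1" using D by (simp add: sum_p0)
    \<comment> \<open>Outputs of \<open>exp_mech\<close> are basis vectors whatever its input, so
      this covers also the small \<open>n\<close> for which \<open>?p n\<close> may fail to be a
      probability vector.\<close>
    show "set_pmf (?W n) \<subseteq> range (\<lambda>j. axis j 1)" for n
      by (auto simp: exp_mech_def)
    show "(\<Sum>j\<in>UNIV. (?\<kappa> *\<^sub>R \<Delta>) $ j) = 0"
      using assms(4) unfolding vector_scaleR_component by (simp only: scaleR_right.sum[symmetric]) simp
    have "\<forall>\<^sub>F n in sequentially. 0 < p\<^sub>0 $ j + (1 / sqrt n) * \<Delta> $ j" for j
    proof (rule order_tendstoD)
      show "(\<lambda>n. p\<^sub>0 $ j + (1 / sqrt n) * \<Delta> $ j) \<longlonglongrightarrow> p\<^sub>0 $ j + 0 * \<Delta> $ j"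
        by (intro tendsto_intros inverse_sqrt_tendsto_0)
    qed (use assms(3) in simp)
    hence "\<forall>\<^sub>F n in sequentially. \<forall>j. 0 < p\<^sub>0 $ j + (1 / sqrt n) * \<Delta> $ j"
      by (rule eventually_all_finite)
    \<comment> \<open>The strict positivity of \<open>p\<^sub>0\<close> absorbs the perturbation
      once \<open>n\<close> is large; from then on \<open>multinomial1 (?p n)\<close> has the
      intended cell probabilities.\<close>
    hence pv: "\<forall>\<^sub>F n in sequentially. prob_vector (?p n)"
    proof eventually_elim
      case (elim n)
      have "(\<Sum>j\<in>UNIV. ?p n $ j) = (\<Sum>j\<in>UNIV. p\<^sub>0 $ j) + 1 / sqrt n * (\<Sum>j\<in>UNIV. \<Delta> $ j)"
        by (simp add: sum.distrib sum_distrib_left)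
      thus ?case using elim assms(4) sum_p0 by (auto simp: prob_vector_def intro: less_imp_le)
    qed
    fix j
    \<comment> \<open>By affinity the rescaled deviation equals its limit exactly for large
      \<open>n\<close>.\<close>
    have "\<forall>\<^sub>F n in sequentially. (?\<kappa> *\<^sub>R \<Delta>) $ j = sqrt n * (pmf (?W n) (axis j 1) - private_p \<epsilon> p\<^sub>0 $ j)"
      using pv eventually_gt_at_top[of 0]
    proof eventually_elim
      case (elim n)
      have "private_p \<epsilon> (?p n) $ j - private_p \<epsilon> p\<^sub>0 $ j = ?\<kappa> * \<Delta> $ j / sqrt n"
        unfolding private_p_nth diff_divide_distrib[symmetric] by (simp add: distrib_left)
      thus ?case
        unfolding pmf_private_entry[OF assms(1) elim(1)] using elim(2) by simp
    qed
    thus "(\<lambda>n. sqrt n * (pmf (?W n) (axis j 1) - private_p \<epsilon> p\<^sub>0 $ j)) \<longlonglongrightarrow> (?\<kappa> *\<^sub>R \<Delta>) $ j"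
      by (rule Lim_transform_eventually[OF tendsto_const])
  qed
  moreover have "(\<Sum>j\<in>UNIV. ((?\<kappa> *\<^sub>R \<Delta>) $ j)\<^sup>2 / private_p \<epsilon> p\<^sub>0 $ j)
      = ?\<kappa>\<^sup>2 * (\<Sum>j\<in>UNIV. (\<Delta> $ j)\<^sup>2 / private_p \<epsilon> p\<^sub>0 $ j)"
    unfolding sum_distrib_left vector_scaleR_component real_scaleR_def power_mult_distrib by simp
  ultimately show ?thesis
    by (simp only: T_Exp_law_def T_Exp_eq_pearson private_hist_eq_iid_sum_pmf)
qed

theorem theorem5p4:
  fixes \<epsilon> :: real and p\<^sub>0 :: "real ^ 'd"
  assumes "\<epsilon> > 0"
    and "prob_vector p\<^sub>0"
    and "\<And>j. p\<^sub>0 $ j > 0"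
  shows "weak_conv_m (\<lambda>n. T_Exp_law n \<epsilon> p\<^sub>0 p\<^sub>0) (chi_square (CARD('d) - 1))
    \<and> (\<forall>\<Delta> :: real ^ 'd. (\<Sum>j\<in>UNIV. \<Delta> $ j) = 0 \<longrightarrow>
      weak_conv_m (\<lambda>n. T_Exp_law n \<epsilon> p\<^sub>0 (p\<^sub>0 + (1 / sqrt (real n)) *\<^sub>R \<Delta>))
        (noncentral_chi_square (CARD('d) - 1)
          (((exp \<epsilon> - 1) / (exp \<epsilon> + real CARD('d) - 1))\<^sup>2
            * (\<Sum>j\<in>UNIV. (\<Delta> $ j)\<^sup>2 / private_p \<epsilon> p\<^sub>0 $ j))))"
  \<comment> \<open>The null hypothesis is the case of zero perturbation, with noncentrality
    0.\<close>
  using weak_conv_T_Exp_law[OF assms] weak_conv_T_Exp_law[OF assms, of 0] by simp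

end
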